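(* There is a family, of cardinality the continuum, of pairwise disjoint subspaces of $\mathfrak{M}(M(\mathbb{T}))$, each of which is homeomorphic to $\beta\mathbb{Z}$.
   Context: $\mathbb{T}$ is the circle group (identified with $\mathbb{R}/2\pi\mathbb{Z}$). $M(\mathbb{T})$ is the commutative unital Banach algebra of complex regular Borel measures on $\mathbb{T}$, with convolution as multiplication, the total variation norm, and unit $\delta_0$. $\mathfrak{M}(M(\mathbb{T}))$ is its Gelfand (maximal ideal) space: the set of all nonzero multiplicative linear functionals on $M(\mathbb{T})$ with the weak$^*$ topology, which is a compact Hausdorff space. $\beta\mathbb{Z}$ is the Stone–Čech compactification of the discrete space $\mathbb{Z}$. *)

theory Defs
  imports "HOL-Analysis.Analysis" "HOL-Library.Equipollence"
begin

section \<open>Complex measures\<close>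

text \<open>A complex measure on the measurable space of \<open>M\<close> is a countably additive complex-valued set
  function; only \<open>space M\<close> and \<open>sets M\<close> matter. Set functions are normalised to vanish off
  \<open>sets M\<close>, so that equality of measures is equality of functions. Countable additivity at the
  empty family forces the value 0 at the empty set.\<close>

definition complex_measures :: "'a measure \<Rightarrow> ('a set \<Rightarrow> complex) set" where
  "complex_measures M =
    {\<mu>. (\<forall>A. A \<notin> sets M \<longrightarrow> \<mu> A = 0) \<and>
        (\<forall>A :: nat \<Rightarrow> 'a set. range A \<subseteq> sets M \<longrightarrow> disjoint_family A \<longrightarrow>
            (\<lambda>n. \<mu> (A n)) sums \<mu> (\<Union>n. A n))}"

definition variation :: "'a measure \<Rightarrow> ('a set \<Rightarrow> complex) \<Rightarrow> 'a set \<Rightarrow> ennreal" where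
  "variation M \<mu> E =
    (SUP A \<in> {A :: nat \<Rightarrow> 'a set. range A \<subseteq> sets M \<and> disjoint_family A \<and> (\<Union>n. A n) = E}.
       \<Sum>n. ennreal (cmod (\<mu> (A n))))"

text \<open>The positive part of the Jordan decomposition of a real (signed) measure \<open>\<nu>\<close>:
  \<open>\<nu>\<^sup>+(E)\<close> is the supremum of \<open>\<nu>(A)\<close> over measurable \<open>A \<subseteq> E\<close>. The coercion \<^const>\<open>ennreal\<close>
  truncates negative values to 0, which does not affect the supremum as \<open>A = {}\<close> is allowed.
  The negative part of \<open>\<nu>\<close> is the positive part of \<open>-\<nu>\<close>.\<close>

definition positive_part :: "'a measure \<Rightarrow> ('a set \<Rightarrow> real) \<Rightarrow> 'a measure" where
  "positive_part M \<nu> =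
    measure_of (space M) (sets M) (\<lambda>E. SUP A \<in> {A \<in> sets M. A \<subseteq> E}. ennreal (\<nu> A))"

definition complex_measure_integral ::
    "'a measure \<Rightarrow> ('a set \<Rightarrow> complex) \<Rightarrow> ('a \<Rightarrow> complex) \<Rightarrow> complex" where
  "complex_measure_integral M \<mu> f =
     (integral\<^sup>L (positive_part M (\<lambda>A. Re (\<mu> A))) f
       - integral\<^sup>L (positive_part M (\<lambda>A. - Re (\<mu> A))) f)
     + \<i> * (integral\<^sup>L (positive_part M (\<lambda>A. Im (\<mu> A))) f
       - integral\<^sup>L (positive_part M (\<lambda>A. - Im (\<mu> A))) f)"


section \<open>The measure algebra of the circle group\<close>

text \<open>The circle group is realised as the multiplicative group of complex numbers of modulus 1,
  which \<open>t \<mapsto> exp(i t)\<close> identifies with \<open>\<real>/2\<pi>\<int>\<close>.\<close>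

abbreviation circle :: "complex set" where
  "circle \<equiv> sphere 0 1"

abbreviation circle_borel :: "complex measure" where
  "circle_borel \<equiv> restrict_space borel circle"

definition M_circle :: "(complex set \<Rightarrow> complex) set" where
  "M_circle =
    {\<mu> \<in> complex_measures circle_borel.
       \<forall>E \<in> sets circle_borel. \<forall>\<epsilon> > 0. \<exists>K U.
         compact K \<and> openin (top_of_set circle) U \<and> K \<subseteq> E \<and> E \<subseteq> U \<and>
         variation circle_borel \<mu> (U - K) < \<epsilon>}"

text \<open>\<open>(\<mu> * \<nu>)(E) = \<integral> \<mu>(E t\<^sup>-\<^sup>1) d\<nu>(t)\<close>.\<close>

definition convolution ::
    "(complex set \<Rightarrow> complex) \<Rightarrow> (complex set \<Rightarrow> complex) \<Rightarrow> complex set \<Rightarrow> complex" where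
  "convolution \<mu> \<nu> E =
    (if E \<in> sets circle_borel
     then complex_measure_integral circle_borel \<nu> (\<lambda>t. \<mu> {s \<in> circle. s * t \<in> E})
     else 0)"

text \<open>Functionals are functions on \<^const>\<open>M_circle\<close>, with the usual convention of value
  \<^const>\<open>undefined\<close> elsewhere. No continuity is required.\<close>

definition M_circle_characters :: "((complex set \<Rightarrow> complex) \<Rightarrow> complex) set" where
  "M_circle_characters =
    {\<phi> \<in> extensional M_circle.
       (\<forall>\<mu> \<in> M_circle. \<forall>\<nu> \<in> M_circle. \<phi> (\<lambda>E. \<mu> E + \<nu> E) = \<phi> \<mu> + \<phi> \<nu>) \<and>
       (\<forall>c. \<forall>\<mu> \<in> M_circle. \<phi> (\<lambda>E. c * \<mu> E) = c * \<phi> \<mu>) \<and>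
       (\<forall>\<mu> \<in> M_circle. \<forall>\<nu> \<in> M_circle. \<phi> (convolution \<mu> \<nu>) = \<phi> \<mu> * \<phi> \<nu>) \<and>
       (\<exists>\<mu> \<in> M_circle. \<phi> \<mu> \<noteq> 0)}"

text \<open>The weak-* topology is the topology of pointwise convergence on \<^const>\<open>M_circle\<close>.\<close>

definition gelfand_space :: "((complex set \<Rightarrow> complex) \<Rightarrow> complex) topology" where
  "gelfand_space =
    subtopology (product_topology (\<lambda>_. euclidean) M_circle) M_circle_characters"


section \<open>The Stone--Cech compactification\<close>

text \<open>The closure of the image of \<open>X\<close> under evaluation in the cube \<open>[0,1]\<close> to the power
  \<open>C(X,[0,1])\<close>.\<close>

definition unit_interval_maps :: "'a topology \<Rightarrow> ('a \<Rightarrow> real) set" where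
  "unit_interval_maps X =
    {f \<in> extensional (topspace X). continuous_map X (top_of_set {0..1}) f}"

definition stone_cech_cube :: "'a topology \<Rightarrow> (('a \<Rightarrow> real) \<Rightarrow> real) topology" where
  "stone_cech_cube X = product_topology (\<lambda>_. top_of_set {0..1}) (unit_interval_maps X)"

definition stone_cech_embedding :: "'a topology \<Rightarrow> 'a \<Rightarrow> ('a \<Rightarrow> real) \<Rightarrow> real" where
  "stone_cech_embedding X x = (\<lambda>f \<in> unit_interval_maps X. f x)"

definition stone_cech :: "'a topology \<Rightarrow> (('a \<Rightarrow> real) \<Rightarrow> real) topology" where
  "stone_cech X =
    subtopology (stone_cech_cube X)
      (stone_cech_cube X closure_of (stone_cech_embedding X ` topspace X))"

end

theory Submission
  imports Defs
begin

text \<open>The Fourier coefficients \<open>\<mu> \<mapsto> \<integral> t\<^sup>m d\<mu>\<close> are characters of the measure algebra, and so are their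
  pointwise limits along ultrafilters. The exponents \<open>4\<^sup>m\<close> form an interpolation set: every set \<open>D\<close> of
  indices is separated from its complement by a point \<open>t\<close> of the circle, in that
  \<open>Re t\<^bsup>4^m\<^esup> \<le> -1/2\<close> for \<open>m \<in> D\<close> and \<open>Re t\<^bsup>4^m\<^esup> \<ge> 1/2\<close> otherwise. Evaluating at the point mass at \<open>t\<close>
  shows that the characters with exponents \<open>4\<^sup>m\<close> have the Stone--Cech compactification of the
  naturals as closure. Its remainder contains continuum many disjoint copies of the
  compactification of the integers: attach to \<open>n\<close> and \<open>\<alpha> \<subseteq> \<nat>\<close> the infinite set of codes of the
  triples \<open>(n, k, \<alpha> \<inter> {0..<k})\<close>, let \<open>\<psi>\<^sub>\<alpha>\<^sub>,\<^sub>n\<close> be a limit of the characters along this set as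
  \<open>k \<rightarrow> \<infinity>\<close>, and take the closure of \<open>{\<psi>\<^sub>\<alpha>\<^sub>,\<^sub>n | n}\<close> for each \<open>\<alpha>\<close>. For fixed \<open>\<alpha>\<close> the sets are disjoint, and
  for distinct \<open>\<alpha>\<close>, \<open>\<beta>\<close> and fixed \<open>n\<close> only finitely many codes agree, so points of the circle
  separate all the limits involved.\<close>

section \<open>The Stone--Cech compactification of a discrete space\<close>

lemma stone_cech_embedding_subset_closure:
  "stone_cech_embedding X ` topspace X \<subseteq> stone_cech_cube X closure_of (stone_cech_embedding X ` topspace X)"
proof (rule closure_of_subset)
  show "stone_cech_embedding X ` topspace X \<subseteq> topspace (stone_cech_cube X)"
    by (force simp: stone_cech_cube_def stone_cech_embedding_def unit_interval_maps_def continuous_map_def)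
qed

lemma stone_cech_topspace:
  "topspace (stone_cech X) = stone_cech_cube X closure_of (stone_cech_embedding X ` topspace X)"
  by (simp add: stone_cech_def closure_of_subset_topspace Int_absorb1)

lemma stone_cech_dense:
  "stone_cech X closure_of (stone_cech_embedding X ` topspace X) = topspace (stone_cech X)"
  unfolding stone_cech_topspace unfolding stone_cech_def closure_of_subtopology
  using stone_cech_embedding_subset_closure[of X] by (simp add: Int_absorb1)

lemma stone_cech_embedding_in_topspace:
  "x \<in> topspace X \<Longrightarrow> stone_cech_embedding X x \<in> topspace (stone_cech X)"
  unfolding stone_cech_topspace using stone_cech_embedding_subset_closure[of X] by blast

lemma compact_space_stone_cech: "compact_space (stone_cech X)"
proof -
  have "compact_space (stone_cech_cube X)"
    by (auto simp: stone_cech_cube_def compact_space_product_topology compact_space_subtopology)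
  then show ?thesis
    unfolding stone_cech_def
    by (intro compact_space_subtopology closedin_compact_space) auto
qed

lemma continuous_map_stone_cech_eval:
  assumes "f \<in> unit_interval_maps X"
  shows "continuous_map (stone_cech X) euclideanreal (\<lambda>x. x f)"
proof -
  have "continuous_map (stone_cech X) (top_of_set {0..1}) (\<lambda>x. x f)"
    unfolding stone_cech_def stone_cech_cube_def
    by (intro continuous_map_from_subtopology continuous_map_product_projection[OF assms, of "\<lambda>_. top_of_set {0..1::real}"])
  then show ?thesis
    using continuous_map_in_subtopology by blast
qed

section \<open>Extension of functions, separation and free points over a discrete space\<close>

abbreviation (input) stone_cech_discrete :: "(('a \<Rightarrow> real) \<Rightarrow> real) topology" where
  "stone_cech_discrete \<equiv> stone_cech (discrete_topology UNIV)"

abbreviation (input) discrete_embedding :: "'a \<Rightarrow> ('a \<Rightarrow> real) \<Rightarrow> real" where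
  "discrete_embedding \<equiv> stone_cech_embedding (discrete_topology UNIV)"

text \<open>The coordinates of the cube are maps into [0,1], so the real and imaginary parts of g
  are moved affinely into that interval. Evaluation at the two resulting coordinates, moved back, is
  the extension.\<close>

lemma stone_cech_discrete_extension:
  fixes g :: "'a \<Rightarrow> complex"
  assumes "bounded (range g)"
  obtains G where "continuous_map stone_cech_discrete euclidean G"
    "\<And>n. G (discrete_embedding n) = g n"
proof -
  obtain B0 where B0: "\<And>n. norm (g n) \<le> B0"
    using assms by (auto simp: bounded_iff)
  \<comment> \<open>The maximum with 1 keeps the divisor \<open>2 * B\<close> positive.\<close>
  define B where "B = max B0 1"
  have B: "B > 0" "\<And>n. norm (g n) \<le> B"
    using B0 by (auto simp: B_def le_max_iff_disj)
  define fr where "fr n = (Re (g n) + B) / (2 * B)" for n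
  define fi where "fi n = (Im (g n) + B) / (2 * B)" for n
  have re: "\<bar>Re (g n)\<bar> \<le> B" "\<bar>Im (g n)\<bar> \<le> B" for n
    using B(2)[of n] abs_Re_le_cmod[of "g n"] abs_Im_le_cmod[of "g n"] by linarith+
  have u: "fr \<in> unit_interval_maps (discrete_topology UNIV)" "fi \<in> unit_interval_maps (discrete_topology UNIV)"
    using re \<open>B > 0\<close> unfolding unit_interval_maps_def fr_def fi_def
    by (auto simp: extensional_def field_simps abs_le_iff) (smt (verit))+
  define G where "G x = complex_of_real (2 * B * x fr - B) + \<i> * complex_of_real (2 * B * x fi - B)" for x :: "('a \<Rightarrow> real) \<Rightarrow> real"
  have G: "continuous_map stone_cech_discrete euclidean G"
    unfolding G_def
  proof (rule continuous_map_add)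
    show "continuous_map stone_cech_discrete euclidean (\<lambda>x. complex_of_real (2 * B * x fr - B))"
      using continuous_map_compose[OF continuous_map_stone_cech_eval[OF u(1)],
          of euclidean "\<lambda>r. complex_of_real (2 * B * r - B)"]
      by (simp add: o_def continuous_intros)
    show "continuous_map stone_cech_discrete euclidean (\<lambda>x. \<i> * complex_of_real (2 * B * x fi - B))"
      using continuous_map_compose[OF continuous_map_stone_cech_eval[OF u(2)],
          of euclidean "\<lambda>r. \<i> * complex_of_real (2 * B * r - B)"]
      by (simp add: o_def continuous_intros)
  qed
  have "G (discrete_embedding n) = g n" for n
    unfolding G_def using u B(1)
    by (simp add: stone_cech_embedding_def fr_def fi_def complex_eq_iff)
  with G show ?thesis by (rule that)
qed

text \<open>Closure commutes with finite unions and the embedded points are dense, so a point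
  outside one of the two closures must lie in the other.\<close>

lemma stone_cech_discrete_closure_Un:
  "stone_cech_discrete closure_of (discrete_embedding ` A) \<union>
   stone_cech_discrete closure_of (discrete_embedding ` (- A)) = topspace stone_cech_discrete"
proof -
  have "discrete_embedding ` A \<union> discrete_embedding ` (- A) = discrete_embedding ` UNIV"
    by blast
  then show ?thesis
    using stone_cech_dense[of "discrete_topology UNIV"] by (simp flip: closure_of_Un)
qed

text \<open>Preimages of closed sets are closed. This carries every closed constraint on generators
  over to their limit points.\<close>

lemma closure_of_imp_closed:
  assumes "x \<in> X closure_of S" "continuous_map X euclidean G" "closed K" "\<And>y. y \<in> S \<Longrightarrow> G y \<in> K"
  shows "G x \<in> K"
  using assms by (intro forall_in_closure_of[of x X S "\<lambda>x. G x \<in> K"] closedin_continuous_map_preimage[of X euclidean]) auto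

text \<open>A threshold strictly between the values of x and y at the coordinate f cuts the index
  set in two. Continuity of that coordinate excludes each point from the wrong closure, and the two
  closures cover the space.\<close>

lemma stone_cech_discrete_separation_aux:
  fixes x :: "('a \<Rightarrow> real) \<Rightarrow> real"
  assumes x: "x \<in> topspace stone_cech_discrete" and y: "y \<in> topspace stone_cech_discrete"
    and f: "f \<in> unit_interval_maps (discrete_topology UNIV)" and less: "x f < y f"
  shows "\<exists>A. x \<in> stone_cech_discrete closure_of (discrete_embedding ` A) \<and>
    y \<in> stone_cech_discrete closure_of (discrete_embedding ` (- A))"
proof -
  obtain c where c: "x f < c" "c < y f" using less dense by blast
  define A where "A = {n. f n < c}"
  note cont = continuous_map_stone_cech_eval[OF f]
  have "x \<notin> stone_cech_discrete closure_of (discrete_embedding ` (- A))"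
  proof
    assume "x \<in> stone_cech_discrete closure_of (discrete_embedding ` (- A))"
    then have "x f \<in> {c..}"
      by (rule closure_of_imp_closed[OF _ cont]) (use f in \<open>auto simp: A_def stone_cech_embedding_def\<close>)
    with c show False by simp
  qed
  moreover have "y \<notin> stone_cech_discrete closure_of (discrete_embedding ` A)"
  proof
    assume "y \<in> stone_cech_discrete closure_of (discrete_embedding ` A)"
    then have "y f \<in> {..c}"
      by (rule closure_of_imp_closed[OF _ cont]) (use f in \<open>auto simp: A_def stone_cech_embedding_def\<close>)
    with c show False by simp
  qed
  ultimately show ?thesis
    using x y stone_cech_discrete_closure_Un[of A] by blast
qed

text \<open>Points of the cube are extensional, so distinct ones differ at some coordinate. In
  ultrafilter terms, A belongs to x and its complement to y; hence separating sets of indices is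
  enough to separate points.\<close>

lemma stone_cech_discrete_separation:
  fixes x y :: "('a \<Rightarrow> real) \<Rightarrow> real"
  assumes x: "x \<in> topspace stone_cech_discrete" and y: "y \<in> topspace stone_cech_discrete" and "x \<noteq> y"
  obtains A where "x \<in> stone_cech_discrete closure_of (discrete_embedding ` A)"
    "y \<in> stone_cech_discrete closure_of (discrete_embedding ` (- A))"
proof -
  have "x \<in> extensional (unit_interval_maps (discrete_topology UNIV))"
    "y \<in> extensional (unit_interval_maps (discrete_topology UNIV))"
    using x y by (auto simp: stone_cech_def stone_cech_cube_def PiE_def)
  then obtain f where f: "f \<in> unit_interval_maps (discrete_topology UNIV)" "x f \<noteq> y f"
    using \<open>x \<noteq> y\<close> extensionalityI by blast
  consider "x f < y f" | "y f < x f" using f(2) by linarith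
  then show ?thesis
    using stone_cech_discrete_separation_aux[OF x y f(1)] stone_cech_discrete_separation_aux[OF y x f(1)] that
    by cases (metis, metis double_complement)
qed

text \<open>By compactness the decreasing closures of the tails have a common point. It plays the
  role of a free ultrafilter, along which limits for k tending to infinity are taken.\<close>

lemma stone_cech_discrete_free_point:
  obtains u :: "(nat \<Rightarrow> real) \<Rightarrow> real" where
    "\<And>k. u \<in> stone_cech_discrete closure_of (discrete_embedding ` {k..})"
proof -
  let ?C = "\<lambda>k::nat. stone_cech_discrete closure_of (discrete_embedding ` {k..})"
  have "(\<Inter>k. ?C k) \<noteq> {}"
  proof (rule compact_space_imp_nest[OF compact_space_stone_cech])
    show "closedin stone_cech_discrete (?C k)" for k by simp
    have "discrete_embedding ` {k..} \<subseteq> topspace stone_cech_discrete" for k :: nat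
      by (auto intro: stone_cech_embedding_in_topspace)
    from closure_of_subset[OF this] show "?C k \<noteq> {}" for k by fastforce
    show "decseq ?C"
      by (intro decseq_SucI closure_of_mono image_mono) auto
  qed
  then show ?thesis using that by blast
qed

section \<open>Interpolation by powers on the circle\<close>

text \<open>The angle of t is pi times the number whose base-4 digits form the indicator of D.
  Raising to the power 4^m turns the digits before position m into full turns and the digit at m
  into a half turn or nothing. The later digits amount to an angle of at most pi/3, whose cosine is
  at least 1/2.\<close>

lemma circle_lacunary_separation:
  fixes D :: "nat set"
  obtains t where "t \<in> circle" "\<And>m. m \<in> D \<Longrightarrow> Re (t ^ 4 ^ m) \<le> - 1 / 2" "\<And>m. m \<notin> D \<Longrightarrow> 1 / 2 \<le> Re (t ^ 4 ^ m)"
proof -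
  define a where "a j = (if j \<in> D then (1/4)^j else 0 :: real)" for j
  define \<theta> where "\<theta> = (\<Sum>j. a j)"
  define t where "t = cis (pi * \<theta>)"
  have a: "0 \<le> a j" "a j \<le> (1/4)^j" for j by (auto simp: a_def)
  have summ: "summable a"
    by (rule summable_comparison_test'[of "\<lambda>j. (1/4)^j" 0]) (use a in \<open>auto simp: abs_of_nonneg\<close>)
  have key: "(if m \<in> D then - Re (t ^ 4 ^ m) else Re (t ^ 4 ^ m)) \<ge> 1/2" for m
  proof -
    \<comment> \<open>The digits after position m, rescaled; comparison with a geometric series
      bounds them by 1/3.\<close>
    define r where "r = (\<Sum>j. 4 ^ m * a (j + Suc m))"
    have sr: "summable (\<lambda>j. 4 ^ m * a (j + Suc m))"
      by (intro summable_mult summable_ignore_initial_segment summ)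
    have g: "(\<lambda>j. (1/4) * (1/4)^j :: real) sums (1/3)"
      using sums_mult[OF geometric_sums[of "1/4 :: real"], of "1/4"] by simp
    have le: "4 ^ m * a (j + Suc m) \<le> (1/4) * (1/4)^j" for j
    proof -
      have "4 ^ m * a (j + Suc m) \<le> 4 ^ m * (1/4) ^ (j + Suc m)"
        by (intro mult_left_mono a) auto
      also have "\<dots> = (1/4) * (1/4)^j"
        by (simp add: power_add field_simps)
      finally show ?thesis .
    qed
    have r0: "0 \<le> r" unfolding r_def by (intro suminf_nonneg sr) (simp add: a)
    have r1: "r \<le> 1/3"
      unfolding r_def using suminf_le[OF le sr sums_summable[OF g]] sums_unique[OF g] by simp
    \<comment> \<open>For j < m the factor 4^(m-j) is even, so after multiplication by pi the
      earlier digits give multiples of 2 pi.\<close>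
    have "\<exists>N :: int. 4 ^ m * (\<Sum>j<m. a j) = 2 * of_int N"
    proof
      show "4 ^ m * (\<Sum>j<m. a j) = 2 * of_int (\<Sum>j<m. if j \<in> D then 2 * 4 ^ (m - Suc j) else 0)"
        unfolding sum_distrib_left of_int_sum
      proof (intro sum.cong refl)
        fix j assume "j \<in> {..<m}"
        then obtain k where "m = j + Suc k" using less_iff_Suc_add by auto
        then show "4 ^ m * a j = 2 * real_of_int (if j \<in> D then 2 * 4 ^ (m - Suc j) else 0)"
          by (simp add: a_def power_add field_simps)
      qed
    qed
    then obtain N :: int where N: "4 ^ m * (\<Sum>j<m. a j) = 2 * of_int N" by blast
    have "\<theta> = (\<Sum>j. a (j + Suc m)) + (\<Sum>j<Suc m. a j)"
      unfolding \<theta>_def by (rule suminf_split_initial_segment[OF summ])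
    then have "4 ^ m * \<theta> = r + (2 * of_int N + 4 ^ m * a m)"
      unfolding r_def using N suminf_mult[OF summable_ignore_initial_segment[OF summ], of "4 ^ m" "Suc m"]
      by (simp add: algebra_simps)
    moreover have "4 ^ m * a m = (if m \<in> D then 1 else 0)"
      by (simp add: a_def power_divide)
    moreover have "Re (t ^ 4 ^ m) = cos (pi * (4 ^ m * \<theta>))"
    proof -
      have "t ^ 4 ^ m = cis (real (4 ^ m) * (pi * \<theta>))"
        unfolding t_def by (rule Complex.DeMoivre)
      also have "real (4 ^ m) * (pi * \<theta>) = pi * (4 ^ m * \<theta>)"
        by simp
      finally show ?thesis by (simp only: cis.simps)
    qed
    ultimately have "Re (t ^ 4 ^ m) = cos (pi * r + (if m \<in> D then pi else 0) + of_int N * (2 * pi))"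
      by (simp add: algebra_simps)
    also have "\<dots> = cos (pi * r + (if m \<in> D then pi else 0))"
      using cos.plus_of_int[of "pi * r + (if m \<in> D then pi else 0)" N] by simp
    finally have "Re (t ^ 4 ^ m) = (if m \<in> D then - cos (pi * r) else cos (pi * r))"
      by simp
    moreover have "cos (pi * r) \<ge> cos (pi / 3)"
      using r0 r1 by (intro cos_monotone_0_pi_le) (auto simp: field_simps)
    ultimately show ?thesis by (simp add: cos_60)
  qed
  show ?thesis
    by (rule that[of t]) (use key in \<open>force simp: t_def split: if_splits\<close>)+
qed

section \<open>Jordan decomposition\<close>

text \<open>The coercion replaces negative terms by 0, which can only enlarge the partial sums; the
  inequality survives in the limit.\<close>

lemma ennreal_le_suminf:
  assumes "f sums s"
  shows "ennreal s \<le> (\<Sum>n. ennreal (f n))"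
proof (rule LIMSEQ_le_const2)
  show "(\<lambda>n. ennreal (\<Sum>i<n. f i)) \<longlonglongrightarrow> ennreal s"
    using assms unfolding sums_def by (rule tendsto_ennrealI)
  have "ennreal (\<Sum>i<n. f i) \<le> (\<Sum>n. ennreal (f n))" for n
  proof -
    have "ennreal (\<Sum>i<n. f i) \<le> ennreal (\<Sum>i<n. max 0 (f i))"
      by (intro ennreal_leI sum_mono) auto
    also have "\<dots> = (\<Sum>i<n. ennreal (f i))"
      by (subst sum_ennreal[symmetric], simp) (intro sum.cong refl, simp add: max_def ennreal_neg)
    also have "\<dots> \<le> (\<Sum>n. ennreal (f n))"
      by (rule sum_le_suminf) auto
    finally show ?thesis .
  qed
  then show "\<exists>N. \<forall>n\<ge>N. ennreal (\<Sum>i<n. f i) \<le> (\<Sum>n. ennreal (f n))" by blast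
qed

locale signed_measure =
  fixes M :: "'a measure" and \<nu> :: "'a set \<Rightarrow> real"
  assumes sums_UN: "range A \<subseteq> sets M \<Longrightarrow> disjoint_family A \<Longrightarrow> (\<lambda>n. \<nu> (A n)) sums \<nu> (\<Union>n. A n)"
begin

lemma signed_empty: "\<nu> {} = 0"
proof -
  have "(\<lambda>n::nat. \<nu> {}) sums \<nu> {}"
    using sums_UN[of "\<lambda>_. {}"] by (simp add: disjoint_family_on_def)
  then show ?thesis
    using summable_LIMSEQ_zero sums_summable LIMSEQ_const_iff by blast
qed

lemma signed_Un: "A \<in> sets M \<Longrightarrow> B \<in> sets M \<Longrightarrow> A \<inter> B = {} \<Longrightarrow> \<nu> (A \<union> B) = \<nu> A + \<nu> B"
proof -
  assume *: "A \<in> sets M" "B \<in> sets M" "A \<inter> B = {}"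
  have "(\<lambda>n. \<nu> (binaryset A B n)) sums \<nu> (\<Union>n. binaryset A B n)"
    using * by (intro sums_UN) (auto simp: disjoint_family_on_def binaryset_def)
  moreover have "(\<lambda>n. \<nu> (binaryset A B n)) sums (\<nu> A + \<nu> B)"
    by (rule binaryset_sums) (rule signed_empty)
  ultimately show ?thesis
    unfolding UN_binaryset_eq by (rule sums_unique2)
qed

lemma signed_Diff: "A \<in> sets M \<Longrightarrow> B \<in> sets M \<Longrightarrow> A \<subseteq> B \<Longrightarrow> \<nu> (B - A) = \<nu> B - \<nu> A"
  using signed_Un[of A "B - A"] by (simp add: Un_absorb1)

text \<open>The set function from which \<open>positive_part\<close> is built. It is studied on its
  own because \<open>measure_of\<close> yields it as a measure only once countable additivity is
  established.\<close>

definition upper_variation :: "'a set \<Rightarrow> ennreal" where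
  "upper_variation E = (SUP A \<in> {A \<in> sets M. A \<subseteq> E}. ennreal (\<nu> A))"

lemma upper_variation_ge: "A \<in> sets M \<Longrightarrow> A \<subseteq> E \<Longrightarrow> ennreal (\<nu> A) \<le> upper_variation E"
  unfolding upper_variation_def by (rule SUP_upper) auto

lemma upper_variation_empty: "upper_variation {} = 0"
proof -
  have "{A \<in> sets M. A \<subseteq> {}} = {{}}" by auto
  then show ?thesis by (simp add: upper_variation_def signed_empty)
qed

lemma upper_variation_mono: "A \<subseteq> B \<Longrightarrow> upper_variation A \<le> upper_variation B"
  unfolding upper_variation_def by (rule SUP_subset_mono) auto

lemma upper_variation_superadditive:
  assumes "A \<inter> B = {}"
  shows "upper_variation A + upper_variation B \<le> upper_variation (A \<union> B)"
proof -
  have *: "ennreal (\<nu> A') + ennreal (\<nu> B') \<le> upper_variation (A \<union> B)"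
    if "A' \<in> sets M" "A' \<subseteq> A" "B' \<in> sets M" "B' \<subseteq> B" for A' B'
  proof -
    \<comment> \<open>A set of negative value counts as 0 after coercion, so it is traded for the
      empty set. Both values are then nonnegative and coercion commutes with their sum.\<close>
    define A'' where "A'' = (if \<nu> A' \<ge> 0 then A' else {})"
    define B'' where "B'' = (if \<nu> B' \<ge> 0 then B' else {})"
    have eq: "ennreal (\<nu> A') = ennreal (\<nu> A'')" "ennreal (\<nu> B') = ennreal (\<nu> B'')" "0 \<le> \<nu> A''" "0 \<le> \<nu> B''"
      by (auto simp: A''_def B''_def signed_empty ennreal_neg)
    have s: "A'' \<in> sets M" "A'' \<subseteq> A" "B'' \<in> sets M" "B'' \<subseteq> B"
      using that by (auto simp: A''_def B''_def)
    have "ennreal (\<nu> A') + ennreal (\<nu> B') = ennreal (\<nu> A'' + \<nu> B'')"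
      using eq by simp
    also have "\<nu> A'' + \<nu> B'' = \<nu> (A'' \<union> B'')"
      using s assms by (intro signed_Un[symmetric]) auto
    also have "ennreal \<dots> \<le> upper_variation (A \<union> B)"
      using s by (intro upper_variation_ge) auto
    finally show ?thesis .
  qed
  have ne: "{A' \<in> sets M. A' \<subseteq> E} \<noteq> {}" for E by auto
  have "ennreal (\<nu> A') + upper_variation B \<le> upper_variation (A \<union> B)" if "A' \<in> sets M" "A' \<subseteq> A" for A'
    unfolding upper_variation_def[of B]
    by (subst ennreal_SUP_add_right[OF ne]) (use * that in \<open>auto intro!: SUP_least\<close>)
  then show ?thesis
    unfolding upper_variation_def[of A]
    by (subst ennreal_SUP_add_left[OF ne, symmetric]) (auto intro!: SUP_least)
qed

lemma upper_variation_sum_le: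
  fixes A :: "nat \<Rightarrow> 'a set"
  assumes "disjoint_family A"
  shows "(\<Sum>i<n. upper_variation (A i)) \<le> upper_variation (\<Union>i<n. A i)"
proof (induction n)
  case (Suc n)
  have "(\<Union>i<n. A i) \<inter> A n = {}"
  proof -
    have "A i \<inter> A n = {}" if "i < n" for i
      using assms that by (simp add: disjoint_family_on_def)
    then show ?thesis by blast
  qed
  then have "upper_variation (\<Union>i<n. A i) + upper_variation (A n) \<le> upper_variation ((\<Union>i<n. A i) \<union> A n)"
    by (rule upper_variation_superadditive)
  also have "(\<Union>i<n. A i) \<union> A n = (\<Union>i<Suc n. A i)" by (auto simp: less_Suc_eq)
  finally show ?case
    unfolding sum.lessThan_Suc by (rule order_trans[OF add_right_mono[OF Suc]])
qed (simp add: upper_variation_empty)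

text \<open>Superadditivity over finite unions gives one inequality. For the other, a measurable
  subset of the union is cut into its intersections with the \<open>A n\<close>, and each piece is
  bounded by the upper variation there.\<close>

lemma upper_variation_countably_additive: "countably_additive (sets M) upper_variation"
  unfolding countably_additive_def
proof (intro allI impI antisym)
  fix A :: "nat \<Rightarrow> 'a set"
  assume A: "range A \<subseteq> sets M" "disjoint_family A"
  show "(\<Sum>i. upper_variation (A i)) \<le> upper_variation (\<Union>i. A i)"
  proof (rule suminf_le_const)
    show "(\<Sum>i<n. upper_variation (A i)) \<le> upper_variation (\<Union>i. A i)" for n
      using upper_variation_sum_le[OF A(2), of n] upper_variation_mono[of "\<Union>i<n. A i" "\<Union>i. A i"]
      by (force intro: order_trans)
  qed simp
  show "upper_variation (\<Union>i. A i) \<le> (\<Sum>i. upper_variation (A i))"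
    unfolding upper_variation_def[of "\<Union>i. A i"]
  proof (rule SUP_least, safe)
    fix B assume B: "B \<in> sets M" "B \<subseteq> (\<Union>i. A i)"
    have "(\<lambda>n. \<nu> (B \<inter> A n)) sums \<nu> (\<Union>n. B \<inter> A n)"
      using A B by (intro sums_UN) (auto simp: disjoint_family_on_def)
    also have "(\<Union>n. B \<inter> A n) = B" using B by auto
    finally have "ennreal (\<nu> B) \<le> (\<Sum>n. ennreal (\<nu> (B \<inter> A n)))" by (rule ennreal_le_suminf)
    also have "\<dots> \<le> (\<Sum>n. upper_variation (A n))"
      using A B by (intro suminf_le upper_variation_ge) auto
    finally show "ennreal (\<nu> B) \<le> (\<Sum>n. upper_variation (A n))" .
  qed
qed

lemma emeasure_positive_part: "E \<in> sets M \<Longrightarrow> emeasure (positive_part M \<nu>) E = upper_variation E"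
  unfolding positive_part_def upper_variation_def[symmetric]
  using upper_variation_countably_additive sets.sigma_algebra_axioms[of M]
  by (subst emeasure_measure_of_sigma)
     (auto simp: positive_def upper_variation_empty)

lemma sets_positive_part [simp]: "sets (positive_part M \<nu>) = sets M"
  and space_positive_part [simp]: "space (positive_part M \<nu>) = space M"
  unfolding positive_part_def by (simp_all)

text \<open>A set of infinite upper variation splits into two parts on which the signed measure is at
  least 1 in modulus, one of them again of infinite upper variation; iterating yields a disjoint
  sequence on which countable additivity fails.\<close>

lemma upper_variation_finite: "upper_variation (space M) \<noteq> \<infinity>"
proof
  assume inf: "upper_variation (space M) = \<infinity>"
  have step: "\<exists>F. (F \<in> sets M \<and> upper_variation F = \<infinity>) \<and> F \<subseteq> E \<and> 1 \<le> \<bar>\<nu> (E - F)\<bar>"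
    if E: "E \<in> sets M" "upper_variation E = \<infinity>" for E
  proof -
    \<comment> \<open>The margin \<open>\<bar>\<nu> E\<bar> + 1\<close> makes both A and E - A have
      modulus at least 1, so whichever of them keeps infinite upper variation can be retained and
      the other one discarded.\<close>
    have "ennreal (\<bar>\<nu> E\<bar> + 1) < upper_variation E" by (simp add: E)
    then obtain A where A: "A \<in> sets M" "A \<subseteq> E" "ennreal (\<bar>\<nu> E\<bar> + 1) < ennreal (\<nu> A)"
      unfolding upper_variation_def less_SUP_iff by auto
    have gt: "\<bar>\<nu> E\<bar> + 1 < \<nu> A" by (rule ennreal_less_iff[THEN iffD1, OF _ A(3)]) simp
    have "upper_variation A + upper_variation (E - A) = upper_variation E"
      using plus_emeasure[of A "positive_part M \<nu>" "E - A"] A E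
      by (simp add: emeasure_positive_part Un_absorb1)
    with E consider "upper_variation A = \<infinity>" | "upper_variation (E - A) = \<infinity>" by auto
    then show ?thesis
    proof cases
      case 1
      then show ?thesis using A gt E signed_Diff[of A E] by (intro exI[of _ A]) auto
    next
      case 2
      have "E - (E - A) = A" using A by auto
      with 2 show ?thesis using A gt E by (intro exI[of _ "E - A"]) auto
    qed
  qed
  obtain F :: "nat \<Rightarrow> 'a set" where F: "\<And>n. F n \<in> sets M" "\<And>n. F (Suc n) \<subseteq> F n" "\<And>n. 1 \<le> \<bar>\<nu> (F n - F (Suc n))\<bar>"
    using dependent_nat_choice[of "\<lambda>_ E. E \<in> sets M \<and> upper_variation E = \<infinity>"
        "\<lambda>_ E F. F \<subseteq> E \<and> 1 \<le> \<bar>\<nu> (E - F)\<bar>"] inf step by blast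
  have anti: "F n \<subseteq> F m" if "m \<le> n" for m n
    using lift_Suc_antimono_le[of F] F(2) that by blast
  have "disjoint_family (\<lambda>n. F n - F (Suc n))"
    unfolding disjoint_family_on_def
  proof (intro ballI impI)
    fix m n :: nat assume "m \<noteq> n"
    then consider "Suc m \<le> n" | "Suc n \<le> m" by linarith
    then show "(F m - F (Suc m)) \<inter> (F n - F (Suc n)) = {}"
      using anti by cases blast+
  qed
  then have "(\<lambda>n. \<nu> (F n - F (Suc n))) sums \<nu> (\<Union>n. F n - F (Suc n))"
    using F by (intro sums_UN) auto
  then have "(\<lambda>n. \<nu> (F n - F (Suc n))) \<longlonglongrightarrow> 0"
    using sums_summable summable_LIMSEQ_zero by blast
  then have "eventually (\<lambda>n. \<bar>\<nu> (F n - F (Suc n))\<bar> < 1) sequentially"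
    by (auto dest: tendstoD[where e=1])
  with F(3) show False by (simp add: not_less[symmetric])
qed

lemma finite_measure_positive_part: "finite_measure (positive_part M \<nu>)"
  by (rule finite_measureI) (use upper_variation_finite in \<open>simp add: emeasure_positive_part\<close>)

lemma uminus: "signed_measure M (\<lambda>A. - \<nu> A)"
  by unfold_locales (intro sums_minus sums_UN)

lemma measure_positive_part_ge:
  assumes "A \<in> sets M" "E \<in> sets M" "A \<subseteq> E"
  shows "\<nu> A \<le> measure (positive_part M \<nu>) E"
proof -
  interpret P: finite_measure "positive_part M \<nu>" by (rule finite_measure_positive_part)
  show ?thesis
    using upper_variation_ge[OF assms(1,3)] assms
    by (simp add: P.emeasure_eq_measure flip: emeasure_positive_part)
qed

text \<open>For A inside E, \<nu>(A) equals \<nu>(E) plus the value of -\<nu> at E - A, and the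
  latter is at most the negative part of E. The supremum over A gives the claim.\<close>

lemma measure_positive_part_le:
  assumes E: "E \<in> sets M"
  shows "measure (positive_part M \<nu>) E \<le> \<nu> E + measure (positive_part M (\<lambda>A. - \<nu> A)) E"
proof -
  interpret N: signed_measure M "\<lambda>A. - \<nu> A" by (rule uminus)
  interpret P: finite_measure "positive_part M \<nu>" by (rule finite_measure_positive_part)
  have "upper_variation E \<le> ennreal (\<nu> E + measure (positive_part M (\<lambda>A. - \<nu> A)) E)"
    unfolding upper_variation_def
  proof (rule SUP_least, safe, rule ennreal_leI)
    fix A assume A: "A \<in> sets M" "A \<subseteq> E"
    show "\<nu> A \<le> \<nu> E + measure (positive_part M (\<lambda>A. - \<nu> A)) E"
      using N.measure_positive_part_ge[of "E - A" E] signed_Diff[OF A(1) E A(2)] A E by auto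
  qed
  moreover have "0 \<le> \<nu> E + measure (positive_part M (\<lambda>A. - \<nu> A)) E"
    using N.measure_positive_part_ge[OF E E] by simp
  ultimately show ?thesis
    using E by (simp add: P.emeasure_eq_measure flip: emeasure_positive_part)
qed

text \<open>The preceding inequality, applied to \<nu> and to its negative, supplies both
  directions.\<close>

lemma jordan_decomposition:
  assumes E: "E \<in> sets M"
  shows "\<nu> E = measure (positive_part M \<nu>) E - measure (positive_part M (\<lambda>A. - \<nu> A)) E"
proof -
  interpret N: signed_measure M "\<lambda>A. - \<nu> A" by (rule uminus)
  show ?thesis
    using measure_positive_part_le[OF E] N.measure_positive_part_le[OF E] by simp
qed

end

section \<open>Combinations of finite measures\<close>

definition finite_measures :: "'a measure \<Rightarrow> 'i set \<Rightarrow> ('i \<Rightarrow> 'a measure) \<Rightarrow> bool" where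
  "finite_measures M I m \<longleftrightarrow> finite I \<and> (\<forall>i\<in>I. finite_measure (m i) \<and> sets (m i) = sets M)"

text \<open>Complex measures are treated as finite complex combinations of positive ones, which
  reduces integrals and products to the positive case. Such a representation is far from unique, so
  independence of it has to be shown. The value 0 off \<open>sets M\<close> matches the
  normalisation in \<open>complex_measures\<close>.\<close>

definition measure_combination ::
    "'a measure \<Rightarrow> 'i set \<Rightarrow> ('i \<Rightarrow> complex) \<Rightarrow> ('i \<Rightarrow> 'a measure) \<Rightarrow> 'a set \<Rightarrow> complex" where
  "measure_combination M I c m E =
    (if E \<in> sets M then \<Sum>i\<in>I. c i * complex_of_real (measure (m i) E) else 0)"

lemma complex_measure_decomposition:
  assumes "\<mu> \<in> complex_measures M"
  obtains m :: "nat \<Rightarrow> 'a measure" where "finite_measures M {..<4} m"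
    "\<mu> = measure_combination M {..<4} (\<lambda>j. \<i> ^ j) m"
    "\<And>f. complex_measure_integral M \<mu> f = (\<Sum>j<4. \<i> ^ j * integral\<^sup>L (m j) f)"
proof -
  have sums: "range A \<subseteq> sets M \<Longrightarrow> disjoint_family A \<Longrightarrow> (\<lambda>n. \<mu> (A n)) sums \<mu> (\<Union>n. A n)" for A :: "nat \<Rightarrow> _"
    using assms by (auto simp: complex_measures_def)
  interpret R: signed_measure M "\<lambda>A. Re (\<mu> A)"
    by unfold_locales (intro sums_Re sums)
  interpret I: signed_measure M "\<lambda>A. Im (\<mu> A)"
    by unfold_locales (intro sums_Im sums)
  interpret R': signed_measure M "\<lambda>A. - Re (\<mu> A)" by (rule R.uminus)
  interpret I': signed_measure M "\<lambda>A. - Im (\<mu> A)" by (rule I.uminus)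
  \<comment> \<open>The order of the four Jordan parts is chosen so that the coefficients 1, i, -1,
    -i are the powers of \<open>\<i>\<close>.\<close>
  define m where "m = (!) [positive_part M (\<lambda>A. Re (\<mu> A)), positive_part M (\<lambda>A. Im (\<mu> A)),
    positive_part M (\<lambda>A. - Re (\<mu> A)), positive_part M (\<lambda>A. - Im (\<mu> A))]"
  have lt4: "{..<4} = {0, 1, 2, 3 :: nat}" by auto
  have sum4: "(\<Sum>j<4. \<i> ^ j * h j) = (h 0 - h 2) + \<i> * (h 1 - h 3)" for h :: "nat \<Rightarrow> complex"
    by (simp add: lt4 power3_eq_cube algebra_simps)
  have "finite_measures M {..<4} m"
    unfolding finite_measures_def lt4
    using R.finite_measure_positive_part I.finite_measure_positive_part
      R'.finite_measure_positive_part I'.finite_measure_positive_part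
    by (simp add: m_def)
  moreover have "\<mu> = measure_combination M {..<4} (\<lambda>j. \<i> ^ j) m"
  proof
    fix E show "\<mu> E = measure_combination M {..<4} (\<lambda>j. \<i> ^ j) m E"
    proof (cases "E \<in> sets M")
      case True
      then show ?thesis
        using R.jordan_decomposition[OF True] I.jordan_decomposition[OF True]
        by (simp add: measure_combination_def sum4 m_def complex_eq_iff)
    next
      case False
      then show ?thesis using assms by (simp add: complex_measures_def measure_combination_def)
    qed
  qed
  moreover have "complex_measure_integral M \<mu> f = (\<Sum>j<4. \<i> ^ j * integral\<^sup>L (m j) f)" for f
    unfolding complex_measure_integral_def sum4 by (simp add: m_def)
  ultimately show ?thesis by (rule that)
qed

lemma finite_measures_space: "finite_measures M I m \<Longrightarrow> i \<in> I \<Longrightarrow> space (m i) = space M"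
  by (rule sets_eq_imp_space_eq) (simp add: finite_measures_def)

lemma measure_combination_complex_measures:
  assumes "finite_measures M I m"
  shows "measure_combination M I c m \<in> complex_measures M"
  unfolding complex_measures_def
proof (safe)
  fix A :: "nat \<Rightarrow> 'a set" assume A: "range A \<subseteq> sets M" "disjoint_family A"
  have "(\<lambda>n. c i * complex_of_real (measure (m i) (A n))) sums (c i * complex_of_real (measure (m i) (\<Union>n. A n)))"
    if "i \<in> I" for i
  proof -
    interpret finite_measure "m i" using assms that by (auto simp: finite_measures_def)
    show ?thesis
      using A assms that by (intro sums_mult sums_of_real finite_measure_UNION) (auto simp: finite_measures_def)
  qed
  then have "(\<lambda>n. \<Sum>i\<in>I. c i * complex_of_real (measure (m i) (A n))) sums (\<Sum>i\<in>I. c i * complex_of_real (measure (m i) (\<Union>n. A n)))"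
    by (rule sums_sum)
  then show "(\<lambda>n. measure_combination M I c m (A n)) sums measure_combination M I c m (\<Union>n. A n)"
    using A by (simp add: measure_combination_def range_subsetD sets.countable_UN)
qed (simp add: measure_combination_def)

text \<open>The right-hand side involves the combination only through its values on level sets, so
  for simple functions the integral does not depend on the representation.\<close>

lemma combination_integral_simple:
  fixes s :: "'a \<Rightarrow> complex"
  assumes m: "finite_measures M I m" and s: "simple_function M s"
  shows "(\<Sum>i\<in>I. c i * integral\<^sup>L (m i) s) =
    (\<Sum>y\<in>s ` space M. measure_combination M I c m {x \<in> space M. s x = y} * y)"
proof -
  have "integral\<^sup>L (m i) s = (\<Sum>y\<in>s ` space M. measure (m i) {x \<in> space M. s x = y} *\<^sub>R y)" if "i \<in> I" for i
  proof -
    interpret finite_measure "m i" using m that by (auto simp: finite_measures_def)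
    have "simple_function (m i) s"
      using s m that finite_measures_space[OF m that] simple_function_cong_algebra[of "m i" M s]
      by (auto simp: finite_measures_def)
    then have "Bochner_Integration.simple_bochner_integrable (m i) s"
      by (rule Bochner_Integration.simple_bochner_integrable.intros) simp
    then show ?thesis
      using Bochner_Integration.simple_bochner_integrable_eq_integral[of "m i" s]
      by (simp add: finite_measures_space[OF m that] Bochner_Integration.simple_bochner_integral_def)
  qed
  then have "(\<Sum>i\<in>I. c i * integral\<^sup>L (m i) s) =
    (\<Sum>i\<in>I. \<Sum>y\<in>s ` space M. c i * (complex_of_real (measure (m i) {x \<in> space M. s x = y}) * y))"
    by (simp add: sum_distrib_left scaleR_conv_of_real)
  also have "\<dots> = (\<Sum>y\<in>s ` space M. (\<Sum>i\<in>I. c i * complex_of_real (measure (m i) {x \<in> space M. s x = y})) * y)"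
    by (subst sum.swap) (simp add: sum_distrib_right mult.assoc)
  also have "\<dots> = (\<Sum>y\<in>s ` space M. measure_combination M I c m {x \<in> space M. s x = y} * y)"
  proof (intro sum.cong refl)
    fix y
    have "{x \<in> space M. s x = y} = s -` {y} \<inter> space M" by auto
    then have "{x \<in> space M. s x = y} \<in> sets M" using simple_functionD(2)[OF s, of "{y}"] by simp
    then show "(\<Sum>i\<in>I. c i * complex_of_real (measure (m i) {x \<in> space M. s x = y})) * y =
      measure_combination M I c m {x \<in> space M. s x = y} * y"
      by (simp add: measure_combination_def)
  qed
  finally show ?thesis .
qed

text \<open>The constant bound is integrable because the measures are finite, so dominated
  convergence applies to each summand.\<close>

lemma combination_integral_tendsto:
  fixes f :: "'a \<Rightarrow> complex"
  assumes m: "finite_measures M I m"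
    and F: "\<And>k. F k \<in> borel_measurable M" "\<And>x. x \<in> space M \<Longrightarrow> (\<lambda>k. F k x) \<longlonglongrightarrow> f x"
      "\<And>k x. x \<in> space M \<Longrightarrow> norm (F k x) \<le> B"
    and f: "f \<in> borel_measurable M"
  shows "(\<lambda>k. \<Sum>i\<in>I. c i * integral\<^sup>L (m i) (F k)) \<longlonglongrightarrow> (\<Sum>i\<in>I. c i * integral\<^sup>L (m i) f)"
proof (intro tendsto_sum tendsto_mult tendsto_const)
  fix i assume i: "i \<in> I"
  interpret finite_measure "m i" using m i by (auto simp: finite_measures_def)
  have meas: "borel_measurable (m i) = (borel_measurable M :: ('a \<Rightarrow> complex) set)"
    using m i by (intro measurable_cong_sets) (auto simp: finite_measures_def)
  show "(\<lambda>k. integral\<^sup>L (m i) (F k)) \<longlonglongrightarrow> integral\<^sup>L (m i) f"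
    by (rule integral_dominated_convergence[where w="\<lambda>_. B"])
       (use F f in \<open>auto simp: meas finite_measures_space[OF m i]\<close>)
qed

text \<open>Both sides agree on simple functions, and a bounded measurable f is a pointwise limit of
  simple functions with a common bound.\<close>

lemma combination_integral_unique:
  fixes f :: "'a \<Rightarrow> complex"
  assumes m: "finite_measures M I m" and n: "finite_measures M J n"
    and eq: "measure_combination M I c m = measure_combination M J d n"
    and f: "f \<in> borel_measurable M" and B: "\<And>x. x \<in> space M \<Longrightarrow> norm (f x) \<le> B"
  shows "(\<Sum>i\<in>I. c i * integral\<^sup>L (m i) f) = (\<Sum>j\<in>J. d j * integral\<^sup>L (n j) f)"
proof -
  obtain F where F: "\<forall>k. simple_function M (F k)" "\<forall>x\<in>space M. (\<lambda>k. F k x) \<longlonglongrightarrow> f x"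
    "\<forall>k. \<forall>x\<in>space M. norm (F k x) \<le> 2 * norm (f x)"
    using borel_measurable_implies_sequence_metric[OF f, of 0] by auto
  have meas: "F k \<in> borel_measurable M" for k
    using F(1) borel_measurable_simple_function by blast
  have bound: "norm (F k x) \<le> 2 * B" if "x \<in> space M" for k x
  proof -
    have "norm (F k x) \<le> 2 * norm (f x)" using F(3) that by blast
    with B[OF that] show ?thesis by linarith
  qed
  have lim: "x \<in> space M \<Longrightarrow> (\<lambda>k. F k x) \<longlonglongrightarrow> f x" for x using F(2) by blast
  have "(\<lambda>k. \<Sum>i\<in>I. c i * integral\<^sup>L (m i) (F k)) \<longlonglongrightarrow> (\<Sum>i\<in>I. c i * integral\<^sup>L (m i) f)"
    by (rule combination_integral_tendsto[OF m meas lim bound f])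
  moreover have J: "(\<lambda>k. \<Sum>j\<in>J. d j * integral\<^sup>L (n j) (F k)) \<longlonglongrightarrow> (\<Sum>j\<in>J. d j * integral\<^sup>L (n j) f)"
    by (rule combination_integral_tendsto[OF n meas lim bound f])
  moreover have "(\<Sum>i\<in>I. c i * integral\<^sup>L (m i) (F k)) = (\<Sum>j\<in>J. d j * integral\<^sup>L (n j) (F k))" for k
    using F(1) by (simp add: combination_integral_simple[OF m] combination_integral_simple[OF n] eq)
  ultimately show ?thesis
    using LIMSEQ_unique[OF _ J] by (simp only:)
qed

text \<open>The integral is defined through the Jordan parts, which need not be the given measures;
  both represent the same complex measure, so the uniqueness just shown applies.\<close>

lemma complex_measure_integral_combination:
  fixes f :: "'a \<Rightarrow> complex"
  assumes m: "finite_measures M I m"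
    and f: "f \<in> borel_measurable M" "\<And>x. x \<in> space M \<Longrightarrow> norm (f x) \<le> B"
  shows "complex_measure_integral M (measure_combination M I c m) f = (\<Sum>i\<in>I. c i * integral\<^sup>L (m i) f)"
proof -
  obtain m' :: "nat \<Rightarrow> 'a measure" where m': "finite_measures M {..<4} m'"
    "measure_combination M I c m = measure_combination M {..<4} (\<lambda>j. \<i> ^ j) m'"
    "\<And>f. complex_measure_integral M (measure_combination M I c m) f = (\<Sum>j<4. \<i> ^ j * integral\<^sup>L (m' j) f)"
    using complex_measure_decomposition[OF measure_combination_complex_measures[OF m, of c]] by metis
  show ?thesis
    unfolding m'(3) by (rule combination_integral_unique[OF m'(1) m m'(2)[symmetric] f])
qed

section \<open>Regularity and convolution on the circle\<close>

lemma circle_in_borel: "circle \<in> sets borel"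
  by (intro borel_closed) simp

lemma sets_circle_borel: "E \<in> sets circle_borel \<longleftrightarrow> E \<in> sets borel \<and> E \<subseteq> circle"
  using circle_in_borel by (subst sets_restrict_space_iff) auto

lemma space_circle_borel [simp]: "space circle_borel = circle"
  by (simp add: space_restrict_space)

lemma variation_combination_le:
  assumes m: "finite_measures M I m" and E: "E \<in> sets M"
  shows "variation M (measure_combination M I c m) E \<le> (\<Sum>i\<in>I. ennreal (cmod (c i)) * emeasure (m i) E)"
  unfolding variation_def
proof (rule SUP_least, safe)
  fix A :: "nat \<Rightarrow> 'a set" assume A: "range A \<subseteq> sets M" "disjoint_family A"
  have "ennreal (cmod (measure_combination M I c m (A n))) \<le> (\<Sum>i\<in>I. ennreal (cmod (c i)) * emeasure (m i) (A n))" for n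
  proof -
    have An: "A n \<in> sets M" using A by auto
    have "cmod (measure_combination M I c m (A n)) \<le> (\<Sum>i\<in>I. cmod (c i) * measure (m i) (A n))"
      using An by (auto simp: measure_combination_def norm_mult intro!: sum_norm_le)
    then have "ennreal (cmod (measure_combination M I c m (A n))) \<le> ennreal (\<Sum>i\<in>I. cmod (c i) * measure (m i) (A n))"
      by (rule ennreal_leI)
    also have "\<dots> = (\<Sum>i\<in>I. ennreal (cmod (c i) * measure (m i) (A n)))"
      by (subst sum_ennreal) simp_all
    also have "\<dots> = (\<Sum>i\<in>I. ennreal (cmod (c i)) * emeasure (m i) (A n))"
    proof (intro sum.cong refl)
      fix i assume "i \<in> I"
      then interpret finite_measure "m i" using m by (auto simp: finite_measures_def)
      show "ennreal (cmod (c i) * measure (m i) (A n)) = ennreal (cmod (c i)) * emeasure (m i) (A n)"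
        by (simp add: emeasure_eq_measure ennreal_mult)
    qed
    finally show ?thesis .
  qed
  then have "(\<Sum>n. ennreal (cmod (measure_combination M I c m (A n)))) \<le> (\<Sum>n. \<Sum>i\<in>I. ennreal (cmod (c i)) * emeasure (m i) (A n))"
    by (intro suminf_le) auto
  also have "\<dots> = (\<Sum>i\<in>I. \<Sum>n. ennreal (cmod (c i)) * emeasure (m i) (A n))"
    by (intro suminf_sum) simp
  also have "\<dots> = (\<Sum>i\<in>I. ennreal (cmod (c i)) * emeasure (m i) (\<Union>n. A n))"
  proof (intro sum.cong refl)
    fix i assume "i \<in> I"
    then have "range A \<subseteq> sets (m i)" using m A by (auto simp: finite_measures_def)
    then show "(\<Sum>n. ennreal (cmod (c i)) * emeasure (m i) (A n)) = ennreal (cmod (c i)) * emeasure (m i) (\<Union>n. A n)"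
      using A by (simp add: suminf_emeasure)
  qed
  finally show "(\<Sum>n. ennreal (cmod (measure_combination M I c m (A n)))) \<le> (\<Sum>i\<in>I. ennreal (cmod (c i)) * emeasure (m i) (\<Union>n. A n))" .
qed

lemma finite_measure_circle_regular:
  assumes "finite_measure m" and sets: "sets m = sets circle_borel" and E: "E \<in> sets circle_borel" and "0 < (e::real)"
  obtains K U where "compact K" "open U" "K \<subseteq> E" "E \<subseteq> U" "measure m (U \<inter> circle - K) < e"
proof -
  interpret m: finite_measure m by fact
  have space: "space m = circle" using sets_eq_imp_space_eq[OF sets] by simp
  have meas: "(\<lambda>x. x) \<in> measurable m borel"
    unfolding measurable_cong_sets[OF sets refl] by (rule measurable_restrict_space1) simp
  \<comment> \<open>The image under the inclusion is a finite Borel measure on the plane, where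
    inner and outer regularity are known; each is used with error e/2.\<close>
  define M where "M = distr m borel (\<lambda>x. x)"
  interpret M: finite_measure M
    unfolding M_def by (rule m.finite_measure_distr[OF meas])
  have setsM: "sets M = sets borel" by (simp add: M_def)
  have M: "emeasure M A = emeasure m (A \<inter> circle)" if "A \<in> sets borel" for A
    using that unfolding M_def by (subst emeasure_distr[OF meas]) (auto simp: space)
  have EB: "E \<in> sets borel" "E \<subseteq> circle" using E by (auto simp: sets_circle_borel)
  have fin: "emeasure M (space M) \<noteq> \<infinity>" "emeasure M E \<noteq> \<infinity>" by simp_all
  have half: "0 < e / 2" and "{K. K \<subseteq> E \<and> compact K} \<noteq> {}" using \<open>0 < e\<close> by auto
  from SUP_approx_ennreal[OF this inner_regular[OF setsM fin(1) EB(1)] fin(2)]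
  obtain K where K: "K \<subseteq> E" "compact K" "emeasure M E < emeasure M K + ennreal (e/2)"
    by blast
  from INF_approx_ennreal[OF half outer_regular[OF setsM fin(1) EB(1)] fin(2)]
  obtain U where U: "E \<subseteq> U" "open U" "emeasure M U < emeasure M E + ennreal (e/2)"
    by blast
  have s: "K \<in> sets M" "U \<in> sets M" using K U setsM by (auto simp: compact_imp_closed)
  have "measure M E < measure M K + e/2" "measure M U < measure M E + e/2"
    using K U \<open>0 < e\<close> by (simp_all add: M.emeasure_eq_measure ennreal_less_iff flip: ennreal_plus)
  moreover have "measure M (U - K) = measure M U - measure M K"
    using s K(1) U(1) by (intro M.finite_measure_Diff) auto
  ultimately have "measure M (U - K) < e" by simp
  moreover have "measure M (U - K) = measure m ((U - K) \<inter> circle)"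
    using M[of "U - K"] s setsM by (simp add: measure_def)
  moreover have "(U - K) \<inter> circle = U \<inter> circle - K" by blast
  ultimately have "measure m (U \<inter> circle - K) < e" by simp
  with K U show ?thesis using that by blast
qed

text \<open>Finite Borel measures on the circle are regular. The union of the finitely many compact
  sets and the intersection of the open sets serve all summands at once, and the variation is
  bounded by the weighted sum of the measures.\<close>

lemma measure_combination_M_circle:
  assumes m: "finite_measures circle_borel I m"
  shows "measure_combination circle_borel I c m \<in> M_circle"
  unfolding M_circle_def
proof (safe intro!: measure_combination_complex_measures[OF m])
  fix E and \<epsilon> :: ennreal assume E: "E \<in> sets circle_borel" and "0 < \<epsilon>"
  obtain e where e: "0 < e" "ennreal e < \<epsilon>"
  proof -
    obtain a where a: "0 < a" "a < \<epsilon>" using dense[OF \<open>0 < \<epsilon>\<close>] by blast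
    then obtain e where "a = ennreal e" "0 \<le> e" by (cases a) (auto simp: top_unique)
    with a that show ?thesis by (simp add: ennreal_less_zero_iff)
  qed
  define C where "C = (\<Sum>i\<in>I. cmod (c i))"
  have C: "0 \<le> C" by (simp add: C_def sum_nonneg)
  \<comment> \<open>Scaled so that the weighted total error \<open>C * \<delta>\<close> stays below
    e; adding 1 avoids a zero divisor.\<close>
  define \<delta> where "\<delta> = e / (1 + C)"
  have \<delta>: "0 < \<delta>" "C * \<delta> \<le> e" using e C by (auto simp: \<delta>_def field_simps)
  have "\<exists>K U. compact K \<and> open U \<and> K \<subseteq> E \<and> E \<subseteq> U \<and> measure (m i) (U \<inter> circle - K) < \<delta>" if "i \<in> I" for i
  proof -
    have "finite_measure (m i)" "sets (m i) = sets circle_borel"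
      using m that by (auto simp: finite_measures_def)
    from finite_measure_circle_regular[OF this E \<delta>(1)] show ?thesis by metis
  qed
  then obtain K U where KU: "\<And>i. i \<in> I \<Longrightarrow> compact (K i) \<and> open (U i) \<and> K i \<subseteq> E \<and> E \<subseteq> U i \<and>
      measure (m i) (U i \<inter> circle - K i) < \<delta>"
    by metis
  have fin: "finite I" using m by (simp add: finite_measures_def)
  define K' where "K' = (\<Union>i\<in>I. K i)"
  define U' where "U' = circle \<inter> (\<Inter>i\<in>I. U i)"
  have K': "compact K'" "K' \<subseteq> E" using KU fin by (auto simp: K'_def)
  have "open (\<Inter>i\<in>I. U i)" using KU fin by auto
  then have U': "openin (top_of_set circle) U'" "E \<subseteq> U'" "U' \<in> sets circle_borel"
    using KU E circle_in_borel by (auto simp: U'_def openin_open_Int sets_circle_borel)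
  have K'B: "K' \<in> sets circle_borel"
    using K' E by (auto simp: sets_circle_borel compact_imp_closed)
  have "variation circle_borel (measure_combination circle_borel I c m) (U' - K')
      \<le> (\<Sum>i\<in>I. ennreal (cmod (c i)) * emeasure (m i) (U' - K'))"
    using U' K'B by (intro variation_combination_le[OF m]) auto
  also have "\<dots> \<le> (\<Sum>i\<in>I. ennreal (cmod (c i)) * ennreal \<delta>)"
  proof (intro sum_mono mult_left_mono)
    fix i assume i: "i \<in> I"
    then interpret finite_measure "m i" using m by (auto simp: finite_measures_def)
    have s: "sets (m i) = sets circle_borel" using m i by (auto simp: finite_measures_def)
    have "measure (m i) (U' - K') \<le> measure (m i) (U i \<inter> circle - K i)"
    proof (rule finite_measure_mono)
      show "U' - K' \<subseteq> U i \<inter> circle - K i" using i by (auto simp: U'_def K'_def)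
      show "U i \<inter> circle - K i \<in> sets (m i)"
        using KU[OF i] circle_in_borel by (auto simp: s sets_circle_borel compact_imp_closed)
    qed
    also have "\<dots> \<le> \<delta>" using KU[OF i] by simp
    finally show "emeasure (m i) (U' - K') \<le> ennreal \<delta>"
      by (simp add: emeasure_eq_measure ennreal_leI)
  qed simp
  also have "\<dots> = ennreal (C * \<delta>)"
    using \<delta>(1) by (simp add: C_def sum_distrib_right ennreal_mult[symmetric] sum_ennreal)
  also have "\<dots> \<le> ennreal e" using \<delta>(2) by (rule ennreal_leI)
  also note e(2)
  finally show "\<exists>K U. compact K \<and> openin (top_of_set circle) U \<and> K \<subseteq> E \<and> E \<subseteq> U \<and>
      variation circle_borel (measure_combination circle_borel I c m) (U - K) < \<epsilon>"
    using K' U' by blast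
qed

lemma M_circle_decomposition:
  assumes "\<mu> \<in> M_circle"
  obtains c and m :: "nat \<Rightarrow> complex measure" where "finite_measures circle_borel {..<4} m"
    "\<mu> = measure_combination circle_borel {..<4} c m"
proof -
  have "\<mu> \<in> complex_measures circle_borel" using assms by (simp add: M_circle_def)
  from complex_measure_decomposition[OF this] that show ?thesis by metis
qed

section \<open>Convolution of combinations through images of product measures under
  multiplication\<close>

definition product_pushforward :: "complex measure \<Rightarrow> complex measure \<Rightarrow> complex measure" where
  "product_pushforward m n = distr (m \<Otimes>\<^sub>M n) circle_borel (\<lambda>(x, y). x * y)"

lemma measurable_circle_mult:
  "(\<lambda>(x, y). x * y) \<in> measurable (circle_borel \<Otimes>\<^sub>M circle_borel) circle_borel"
proof (rule measurable_restrict_space2)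
  show "(\<lambda>(x, y). x * y) \<in> space (circle_borel \<Otimes>\<^sub>M circle_borel) \<rightarrow> circle"
    by (auto simp: space_pair_measure norm_mult)
  have id: "(\<lambda>x. x) \<in> borel_measurable circle_borel" by (rule measurable_restrict_space1) simp
  show "(\<lambda>(x, y). x * y :: complex) \<in> borel_measurable (circle_borel \<Otimes>\<^sub>M circle_borel)"
    unfolding case_prod_beta
    by (intro borel_measurable_times measurable_compose[OF measurable_fst id] measurable_compose[OF measurable_snd id])
qed

lemma measurable_translate_integral:
  fixes f :: "complex \<Rightarrow> 'b::{banach, second_countable_topology}"
  assumes m: "finite_measure m" "sets m = sets circle_borel" and f: "f \<in> borel_measurable circle_borel"
  shows "(\<lambda>y. \<integral>x. f (x * y) \<partial>m) \<in> borel_measurable circle_borel"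
proof -
  interpret m: finite_measure m by fact
  show ?thesis
  proof (rule m.borel_measurable_lebesgue_integral)
    have "(\<lambda>(y, x). y * x) \<in> measurable (circle_borel \<Otimes>\<^sub>M m) circle_borel"
      using measurable_circle_mult m
      by (subst measurable_cong_sets[OF sets_pair_measure_cong[OF refl m(2)] refl])
    from measurable_compose[OF this f]
    show "(\<lambda>(y, x). f (x * y)) \<in> borel_measurable (circle_borel \<Otimes>\<^sub>M m)"
      by (simp add: case_prod_beta' mult.commute)
  qed
qed

lemma product_pushforward:
  fixes f :: "complex \<Rightarrow> 'b::{banach, second_countable_topology}"
  assumes m: "finite_measure m" "sets m = sets circle_borel"
    and n: "finite_measure n" "sets n = sets circle_borel"
  shows finite_measure_product_pushforward: "finite_measure (product_pushforward m n)"
    and sets_product_pushforward: "sets (product_pushforward m n) = sets circle_borel"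
    and integral_product_pushforward: "\<And>B. f \<in> borel_measurable circle_borel \<Longrightarrow> (\<And>x. x \<in> circle \<Longrightarrow> norm (f x) \<le> B) \<Longrightarrow>
      integral\<^sup>L (product_pushforward m n) f = (\<integral>y. (\<integral>x. f (x * y) \<partial>m) \<partial>n)"
proof -
  interpret m: finite_measure m by fact
  interpret n: finite_measure n by fact
  interpret mn: pair_sigma_finite m n by unfold_locales
  interpret P: finite_measure "m \<Otimes>\<^sub>M n" by (rule finite_measure_pair_measure) fact+
  have space: "space m = circle" "space n = circle"
    using m n by (auto dest!: sets_eq_imp_space_eq)
  have mult: "(\<lambda>(x, y). x * y) \<in> measurable (m \<Otimes>\<^sub>M n) circle_borel"
    using measurable_circle_mult m n
    by (subst measurable_cong_sets[OF sets_pair_measure_cong[OF m(2) n(2)] refl])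
  show "finite_measure (product_pushforward m n)"
    unfolding product_pushforward_def by (rule P.finite_measure_distr[OF mult])
  show "sets (product_pushforward m n) = sets circle_borel"
    by (simp add: product_pushforward_def)
  show "integral\<^sup>L (product_pushforward m n) f = (\<integral>y. (\<integral>x. f (x * y) \<partial>m) \<partial>n)"
    if f: "f \<in> borel_measurable circle_borel" "\<And>x. x \<in> circle \<Longrightarrow> norm (f x) \<le> B" for B
  proof -
    have "integral\<^sup>L (product_pushforward m n) f = integral\<^sup>L (m \<Otimes>\<^sub>M n) (\<lambda>(x, y). f (x * y))"
      unfolding product_pushforward_def
      by (subst integral_distr[OF mult f(1)]) (simp add: case_prod_beta')
    also have "\<dots> = (\<integral>y. (\<integral>x. f (x * y) \<partial>m) \<partial>n)"
    \<comment> \<open>Boundedness on a finite product measure provides the integrability required by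
      Fubini.\<close>
    proof (rule mn.integral_snd[symmetric], rule P.integrable_const_bound[where B=B])
      show "AE p in m \<Otimes>\<^sub>M n. norm (case p of (x, y) \<Rightarrow> f (x * y)) \<le> B"
        by (intro AE_I2) (auto simp: space_pair_measure space norm_mult intro!: f(2))
      show "(\<lambda>(x, y). f (x * y)) \<in> borel_measurable (m \<Otimes>\<^sub>M n)"
        using measurable_compose[OF mult f(1)] by (simp add: case_prod_beta')
    qed
    finally show ?thesis .
  qed
qed

lemma translate_in_circle_borel:
  assumes "E \<in> sets circle_borel" "t \<in> circle"
  shows "{s \<in> circle. s * t \<in> E} \<in> sets circle_borel"
proof -
  have "(\<lambda>s. (s, t)) \<in> measurable circle_borel (circle_borel \<Otimes>\<^sub>M circle_borel)"
    using assms by (intro measurable_Pair) (auto)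
  from measurable_sets[OF measurable_compose[OF this measurable_circle_mult] assms(1)]
  have "(\<lambda>s. s * t) -` E \<inter> circle \<in> sets circle_borel" by simp
  moreover have "(\<lambda>s. s * t) -` E \<inter> circle = {s \<in> circle. s * t \<in> E}" by auto
  ultimately show ?thesis by simp
qed

lemma finite_measures_product_pushforward:
  assumes m: "finite_measures circle_borel I m" and n: "finite_measures circle_borel J n"
  shows "finite_measures circle_borel (I \<times> J) (\<lambda>(i, j). product_pushforward (m i) (n j))"
  using m n by (auto simp: finite_measures_def finite_measure_product_pushforward sets_product_pushforward)

text \<open>For fixed E the function t -> \<mu>(E t^-1) is a combination of the functions
  \<open>g i\<close>. Fubini, applied to the indicator of E, identifies the integral of
  \<open>g i\<close> against \<open>n j\<close> with the mass of E under the product image.\<close>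

lemma convolution_combination:
  assumes m: "finite_measures circle_borel I m" and n: "finite_measures circle_borel J n"
  shows "convolution (measure_combination circle_borel I c m) (measure_combination circle_borel J d n) =
    measure_combination circle_borel (I \<times> J) (\<lambda>(i, j). c i * d j) (\<lambda>(i, j). product_pushforward (m i) (n j))"
    (is "convolution ?\<mu> ?\<nu> = _")
proof
  fix E
  show "convolution ?\<mu> ?\<nu> E = measure_combination circle_borel (I \<times> J) (\<lambda>(i, j). c i * d j) (\<lambda>(i, j). product_pushforward (m i) (n j)) E"
  proof (cases "E \<in> sets circle_borel")
    case True
    define g where "g i t = measure (m i) {s \<in> circle. s * t \<in> E}" for i t
    have ind: "(indicator E :: complex \<Rightarrow> real) \<in> borel_measurable circle_borel"
      using True by simp
    have g: "g i t = (\<integral>s. indicator E (s * t) \<partial>m i)" if "i \<in> I" "t \<in> circle" for i t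
    proof -
      have sp: "space (m i) = circle" using finite_measures_space[OF m that(1)] by simp
      have "(\<integral>s. indicator E (s * t) \<partial>m i) = (\<integral>s. indicator {s \<in> circle. s * t \<in> E} s \<partial>m i :: real)"
        by (intro Bochner_Integration.integral_cong refl) (auto simp: sp indicator_def)
      also have "\<dots> = measure (m i) ({s \<in> circle. s * t \<in> E} \<inter> space (m i))"
        by simp
      also have "{s \<in> circle. s * t \<in> E} \<inter> space (m i) = {s \<in> circle. s * t \<in> E}" unfolding sp by blast
      finally show ?thesis by (simp add: g_def)
    qed
    have gm: "g i \<in> borel_measurable circle_borel" if "i \<in> I" for i
    proof -
      have "(\<lambda>t. \<integral>s. indicator E (s * t) \<partial>m i :: real) \<in> borel_measurable circle_borel"
        using m that ind by (intro measurable_translate_integral) (auto simp: finite_measures_def)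
      then show ?thesis
        using g[OF that] by (subst measurable_cong[of circle_borel "g i"]) auto
    qed
    have gi: "measure (product_pushforward (m i) (n j)) E = integral\<^sup>L (n j) (g i)" "integrable (n j) (g i)"
      if i: "i \<in> I" and j: "j \<in> J" for i j
    proof -
      have mi: "finite_measure (m i)" "sets (m i) = sets circle_borel" and nj: "finite_measure (n j)" "sets (n j) = sets circle_borel"
        using m n i j by (auto simp: finite_measures_def)
      interpret mi: finite_measure "m i" by fact
      interpret nj: finite_measure "n j" by fact
      have spn: "space (n j) = circle" using finite_measures_space[OF n j] by simp
      have sp: "space (product_pushforward (m i) (n j)) = circle"
        by (simp add: product_pushforward_def)
      have "measure (product_pushforward (m i) (n j)) E = (\<integral>t. indicator E t \<partial>product_pushforward (m i) (n j))"
        using True by (simp add: sp sets_circle_borel Int_absorb2)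
      also have "\<dots> = (\<integral>t. (\<integral>s. indicator E (s * t) \<partial>m i) \<partial>n j)"
        by (rule integral_product_pushforward[OF mi nj ind, of 1]) (simp add: indicator_def)
      also have "\<dots> = integral\<^sup>L (n j) (g i)"
        using g[OF i] by (intro Bochner_Integration.integral_cong) (auto simp: spn)
      finally show "measure (product_pushforward (m i) (n j)) E = integral\<^sup>L (n j) (g i)" .
      show "integrable (n j) (g i)"
      proof (rule nj.integrable_const_bound[where B="measure (m i) (space (m i))"])
        show "g i \<in> borel_measurable (n j)"
          using gm[OF i] by (subst measurable_cong_sets[OF nj(2) refl])
      qed (simp add: g_def mi.bounded_measure)
    qed
    have \<mu>: "?\<mu> {s \<in> circle. s * t \<in> E} = (\<Sum>i\<in>I. c i * complex_of_real (g i t))" if "t \<in> circle" for t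
      using translate_in_circle_borel[OF True that] by (simp add: measure_combination_def g_def)
    have "(\<lambda>t. \<Sum>i\<in>I. c i * complex_of_real (g i t)) \<in> borel_measurable circle_borel"
      by (intro borel_measurable_sum borel_measurable_times borel_measurable_const measurable_compose[OF gm]) simp_all
    moreover have \<mu>': "?\<mu> {s \<in> circle. s * t \<in> E} = (\<Sum>i\<in>I. c i * complex_of_real (g i t))" if "t \<in> space circle_borel" for t
      using that unfolding space_circle_borel by (rule \<mu>)
    ultimately have meas: "(\<lambda>t. ?\<mu> {s \<in> circle. s * t \<in> E}) \<in> borel_measurable circle_borel"
      by (subst measurable_cong[OF \<mu>'])
    have bound: "norm (?\<mu> {s \<in> circle. s * t \<in> E}) \<le> (\<Sum>i\<in>I. cmod (c i) * measure (m i) (space (m i)))" if "t \<in> space circle_borel" for t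
    proof -
      have "g i t \<le> measure (m i) (space (m i))" if "i \<in> I" for i
        using that m by (auto simp: g_def finite_measures_def intro: finite_measure.bounded_measure)
      then show ?thesis
        unfolding \<mu>'[OF that] by (auto simp: norm_mult g_def intro!: sum_norm_le mult_left_mono)
    qed
    \<comment> \<open>Measurability and boundedness of the integrand allow the integral to be
      computed from the given representation of the second measure instead of its Jordan
      parts.\<close>
    have "convolution ?\<mu> ?\<nu> E = (\<Sum>j\<in>J. d j * integral\<^sup>L (n j) (\<lambda>t. ?\<mu> {s \<in> circle. s * t \<in> E}))"
      using True complex_measure_integral_combination[OF n meas bound, of d]
      by (simp add: convolution_def)
    also have "\<dots> = (\<Sum>j\<in>J. d j * (\<Sum>i\<in>I. c i * complex_of_real (measure (product_pushforward (m i) (n j)) E)))"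
    proof (intro sum.cong refl arg_cong2[where f="(*)"])
      fix j assume j: "j \<in> J"
      have spn: "space (n j) = circle" using finite_measures_space[OF n j] by simp
      have "integral\<^sup>L (n j) (\<lambda>t. ?\<mu> {s \<in> circle. s * t \<in> E}) = integral\<^sup>L (n j) (\<lambda>t. \<Sum>i\<in>I. c i * complex_of_real (g i t))"
        by (intro Bochner_Integration.integral_cong refl, rule \<mu>) (simp only: spn)
      also have "\<dots> = (\<Sum>i\<in>I. c i * complex_of_real (integral\<^sup>L (n j) (g i)))"
        using gi(2)[OF _ j] by (subst Bochner_Integration.integral_sum) auto
      also have "\<dots> = (\<Sum>i\<in>I. c i * complex_of_real (measure (product_pushforward (m i) (n j)) E))"
        using gi(1)[OF _ j] by simp
      finally show "integral\<^sup>L (n j) (\<lambda>t. ?\<mu> {s \<in> circle. s * t \<in> E}) =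
        (\<Sum>i\<in>I. c i * complex_of_real (measure (product_pushforward (m i) (n j)) E))" .
    qed
    also have "\<dots> = (\<Sum>(i, j)\<in>I \<times> J. c i * d j * complex_of_real (measure (product_pushforward (m i) (n j)) E))"
      unfolding sum_distrib_left
      by (subst sum.swap, subst sum.cartesian_product) (simp add: mult_ac)
    finally show ?thesis using True by (simp add: measure_combination_def case_prod_beta')
  qed (simp add: convolution_def measure_combination_def)
qed

section \<open>Fourier coefficients and their limits\<close>

text \<open>In the usual sign convention this is the Fourier--Stieltjes coefficient at -k. Natural
  exponents suffice for the powers 4^m.\<close>

definition fourier :: "nat \<Rightarrow> (complex set \<Rightarrow> complex) \<Rightarrow> complex" where
  "fourier k \<mu> = complex_measure_integral circle_borel \<mu> (\<lambda>t. t ^ k)"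

lemma measurable_power_circle: "(\<lambda>t. t ^ k) \<in> borel_measurable circle_borel"
  by (rule measurable_restrict_space1) simp

lemma fourier_combination:
  assumes "finite_measures circle_borel I m"
  shows "fourier k (measure_combination circle_borel I c m) = (\<Sum>i\<in>I. c i * (\<integral>t. t ^ k \<partial>m i))"
  unfolding fourier_def
  by (rule complex_measure_integral_combination[OF assms measurable_power_circle, of _ 1])
     (simp add: norm_power)

text \<open>Two representations placed side by side over the disjoint sum of their index sets
  represent the sum, which yields membership and additivity together.\<close>

lemma
  assumes "\<mu> \<in> M_circle" "\<nu> \<in> M_circle"
  shows M_circle_add: "(\<lambda>E. \<mu> E + \<nu> E) \<in> M_circle"
    and fourier_add: "fourier k (\<lambda>E. \<mu> E + \<nu> E) = fourier k \<mu> + fourier k \<nu>"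
proof -
  obtain c m where m: "finite_measures circle_borel {..<4::nat} m"
    and \<mu>: "\<mu> = measure_combination circle_borel {..<4} c m"
    using M_circle_decomposition[OF assms(1)] by metis
  obtain d n where n: "finite_measures circle_borel {..<4::nat} n"
    and \<nu>: "\<nu> = measure_combination circle_borel {..<4} d n"
    using M_circle_decomposition[OF assms(2)] by metis
  let ?I = "{..<4::nat} <+> {..<4::nat}"
  have mn: "finite_measures circle_borel ?I (case_sum m n)"
    using m n by (auto simp: finite_measures_def)
  have eq: "(\<lambda>E. \<mu> E + \<nu> E) = measure_combination circle_borel ?I (case_sum c d) (case_sum m n)"
    by (auto simp: \<mu> \<nu> measure_combination_def sum.Plus)
  show "(\<lambda>E. \<mu> E + \<nu> E) \<in> M_circle"
    unfolding eq by (rule measure_combination_M_circle[OF mn])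
  show "fourier k (\<lambda>E. \<mu> E + \<nu> E) = fourier k \<mu> + fourier k \<nu>"
    unfolding eq fourier_combination[OF mn] unfolding \<mu> \<nu> fourier_combination[OF m] fourier_combination[OF n]
    by (simp add: sum.Plus)
qed

lemma
  assumes "\<mu> \<in> M_circle"
  shows M_circle_scale: "(\<lambda>E. a * \<mu> E) \<in> M_circle"
    and fourier_scale: "fourier k (\<lambda>E. a * \<mu> E) = a * fourier k \<mu>"
proof -
  obtain c m where m: "finite_measures circle_borel {..<4::nat} m"
    and \<mu>: "\<mu> = measure_combination circle_borel {..<4} c m"
    using M_circle_decomposition[OF assms] by metis
  have eq: "(\<lambda>E. a * \<mu> E) = measure_combination circle_borel {..<4} (\<lambda>i. a * c i) m"
    by (auto simp: \<mu> measure_combination_def sum_distrib_left mult.assoc)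
  show "(\<lambda>E. a * \<mu> E) \<in> M_circle"
    unfolding eq by (rule measure_combination_M_circle[OF m])
  show "fourier k (\<lambda>E. a * \<mu> E) = a * fourier k \<mu>"
    unfolding eq fourier_combination[OF m] unfolding \<mu> fourier_combination[OF m]
    by (simp add: sum_distrib_left mult.assoc)
qed

text \<open>Multiplicativity of the coefficient comes from (x y)^k = x^k y^k, which factors the
  double integral.\<close>

lemma
  assumes "\<mu> \<in> M_circle" "\<nu> \<in> M_circle"
  shows M_circle_convolution: "convolution \<mu> \<nu> \<in> M_circle"
    and fourier_convolution: "fourier k (convolution \<mu> \<nu>) = fourier k \<mu> * fourier k \<nu>"
proof -
  obtain c m where m: "finite_measures circle_borel {..<4::nat} m"
    and \<mu>: "\<mu> = measure_combination circle_borel {..<4} c m"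
    using M_circle_decomposition[OF assms(1)] by metis
  obtain d n where n: "finite_measures circle_borel {..<4::nat} n"
    and \<nu>: "\<nu> = measure_combination circle_borel {..<4} d n"
    using M_circle_decomposition[OF assms(2)] by metis
  note mn = finite_measures_product_pushforward[OF m n]
  note eq = convolution_combination[OF m n, of c d]
  show "convolution \<mu> \<nu> \<in> M_circle"
    unfolding \<mu> \<nu> eq by (rule measure_combination_M_circle[OF mn])
  have int: "(\<integral>t. t ^ k \<partial>product_pushforward (m i) (n j)) = (\<integral>t. t ^ k \<partial>m i) * (\<integral>t. t ^ k \<partial>n j)"
    if i: "i \<in> {..<4}" and j: "j \<in> {..<4}" for i j
  proof -
    have "finite_measure (m i)" "sets (m i) = sets circle_borel" "finite_measure (n j)" "sets (n j) = sets circle_borel"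
      using m n i j by (auto simp: finite_measures_def)
    then have "(\<integral>t. t ^ k \<partial>product_pushforward (m i) (n j)) = (\<integral>y. (\<integral>x. (x * y) ^ k \<partial>m i) \<partial>n j)"
      by (rule integral_product_pushforward[where B=1]) (simp_all add: measurable_power_circle norm_power)
    then show ?thesis by (simp add: power_mult_distrib)
  qed
  have "fourier k (convolution \<mu> \<nu>) = (\<Sum>(i, j)\<in>{..<4} \<times> {..<4}. (c i * d j) * ((\<integral>t. t ^ k \<partial>m i) * (\<integral>t. t ^ k \<partial>n j)))"
    unfolding \<mu> \<nu> eq fourier_combination[OF mn]
    by (intro sum.cong refl) (auto simp: int)
  also have "\<dots> = fourier k \<mu> * fourier k \<nu>"
    unfolding \<mu> \<nu> fourier_combination[OF m] fourier_combination[OF n]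
    by (simp add: sum_product sum.cartesian_product mult_ac)
  finally show "fourier k (convolution \<mu> \<nu>) = fourier k \<mu> * fourier k \<nu>" .
qed

text \<open>Since |t^k| = 1, the weighted total masses bound all coefficients independently of k.
  This gives meaning to the supremum that later dominates the limit characters.\<close>

lemma bdd_above_fourier:
  assumes "\<mu> \<in> M_circle"
  shows "bdd_above (range (\<lambda>k. cmod (fourier k \<mu>)))"
proof -
  obtain c m where m: "finite_measures circle_borel {..<4::nat} m"
    and \<mu>: "\<mu> = measure_combination circle_borel {..<4} c m"
    using M_circle_decomposition[OF assms] by metis
  have "cmod (fourier k \<mu>) \<le> (\<Sum>i<4. cmod (c i) * measure (m i) (space (m i)))" for k
    unfolding \<mu> fourier_combination[OF m]
  proof (rule sum_norm_le)
    fix i :: nat assume i: "i \<in> {..<4}"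
    interpret finite_measure "m i" using m i by (auto simp: finite_measures_def)
    have sp: "space (m i) = circle" using finite_measures_space[OF m i] by simp
    have sets: "sets (m i) = sets circle_borel" using m i by (auto simp: finite_measures_def)
    have meas: "(\<lambda>t. t ^ k) \<in> borel_measurable (m i)"
      using measurable_power_circle measurable_cong_sets[OF sets refl] by blast
    have "cmod (\<integral>t. t ^ k \<partial>m i) \<le> (\<integral>t. 1 \<partial>m i)"
    proof (rule order_trans[OF integral_norm_bound], rule integral_mono)
      show "integrable (m i) (\<lambda>t. cmod (t ^ k))"
        by (rule integrable_norm, rule integrable_const_bound[where B=1])
           (auto simp: meas sp norm_power intro!: AE_I2)
    qed (auto simp: sp norm_power)
    then show "cmod (c i * (\<integral>t. t ^ k \<partial>m i)) \<le> cmod (c i) * measure (m i) (space (m i))"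
      by (simp add: norm_mult mult_left_mono)
  qed
  then show ?thesis by (intro bdd_aboveI2)
qed

text \<open>At t = 1 this is the unit of the convolution algebra. For general t its coefficients are
  the powers of t, so interpolating points of the circle become separating measures.\<close>

definition point_mass :: "complex \<Rightarrow> complex set \<Rightarrow> complex" where
  "point_mass t E = (if E \<in> sets circle_borel \<and> t \<in> E then 1 else 0)"

lemma
  assumes t: "t \<in> circle"
  shows point_mass_M_circle: "point_mass t \<in> M_circle"
    and fourier_point_mass: "fourier k (point_mass t) = t ^ k"
proof -
  define m where "m = distr (count_space {()}) circle_borel (\<lambda>_. t)"
  have meas: "(\<lambda>_. t) \<in> measurable (count_space {()}) circle_borel" using t by simp
  have "finite_measure (count_space {()})" by (rule finite_measure_count_space) simp
  then have fm: "finite_measures circle_borel {()} (\<lambda>_. m)"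
    by (simp add: finite_measures_def m_def finite_measure.finite_measure_distr[OF _ meas])
  have eq: "point_mass t = measure_combination circle_borel {()} (\<lambda>_. 1) (\<lambda>_. m)"
  proof
    fix E
    show "point_mass t E = measure_combination circle_borel {()} (\<lambda>_. 1) (\<lambda>_. m) E"
      by (cases "E \<in> sets circle_borel")
         (auto simp: point_mass_def measure_combination_def m_def measure_distr[OF meas])
  qed
  show "point_mass t \<in> M_circle"
    unfolding eq by (rule measure_combination_M_circle[OF fm])
  show "fourier k (point_mass t) = t ^ k"
    unfolding eq fourier_combination[OF fm] unfolding m_def
    by (simp add: integral_distr[OF meas measurable_power_circle] lebesgue_integral_count_space_finite)
qed

text \<open>The bound makes this set closed under pointwise limits while keeping every coordinate bounded,
  which is what extension to the Stone--Cech compactification needs.\<close>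

definition fourier_dominated_characters :: "((complex set \<Rightarrow> complex) \<Rightarrow> complex) set" where
  "fourier_dominated_characters =
    {\<phi>. (\<forall>\<mu> \<in> M_circle. \<forall>\<nu> \<in> M_circle. \<phi> (\<lambda>E. \<mu> E + \<nu> E) = \<phi> \<mu> + \<phi> \<nu>) \<and>
       (\<forall>c. \<forall>\<mu> \<in> M_circle. \<phi> (\<lambda>E. c * \<mu> E) = c * \<phi> \<mu>) \<and>
       (\<forall>\<mu> \<in> M_circle. \<forall>\<nu> \<in> M_circle. \<phi> (convolution \<mu> \<nu>) = \<phi> \<mu> * \<phi> \<nu>) \<and>
       \<phi> (point_mass 1) = 1 \<and>
       (\<forall>\<mu> \<in> M_circle. cmod (\<phi> \<mu>) \<le> (SUP k. cmod (fourier k \<mu>)))}"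

lemma fourier_in_dominated: "fourier k \<in> fourier_dominated_characters"
  unfolding fourier_dominated_characters_def
  by (intro CollectI conjI ballI allI cSUP_upper[OF UNIV_I bdd_above_fourier])
     (simp_all add: fourier_add fourier_scale fourier_convolution fourier_point_mass)

text \<open>The value 1 at the unit excludes the zero functional, and \<open>M_circle\<close> is
  closed under the three operations, so restriction preserves the identities.\<close>

lemma restrict_dominated_character:
  assumes "\<phi> \<in> fourier_dominated_characters"
  shows "restrict \<phi> M_circle \<in> M_circle_characters"
proof -
  have "point_mass 1 \<in> M_circle" by (rule point_mass_M_circle) simp
  then have "\<exists>\<mu>\<in>M_circle. \<phi> \<mu> \<noteq> 0"
    using assms by (intro bexI[of _ "point_mass 1"]) (auto simp: fourier_dominated_characters_def)
  then show ?thesis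
    using assms
    by (auto simp: fourier_dominated_characters_def M_circle_characters_def
        M_circle_add M_circle_scale M_circle_convolution)
qed

section \<open>Limits of characters and embedded Stone--Cech compactifications\<close>

lemma topspace_gelfand_space: "topspace gelfand_space = M_circle_characters"
proof -
  have "M_circle_characters \<subseteq> extensional M_circle" by (simp add: M_circle_characters_def subset_iff)
  then show ?thesis by (simp add: gelfand_space_def PiE_def Int_absorb1)
qed

text \<open>For each measure the values of the \<open>h n\<close> are bounded and extend
  continuously. The algebraic identities and the bound hold at the dense embedded points and are
  closed conditions, so every point of the compactification yields a dominated character.\<close>

lemma dominated_character_extension:
  fixes h :: "'a \<Rightarrow> (complex set \<Rightarrow> complex) \<Rightarrow> complex"
  assumes h: "\<And>n. h n \<in> fourier_dominated_characters"
  obtains G where "\<And>x. x \<in> topspace stone_cech_discrete \<Longrightarrow> G x \<in> fourier_dominated_characters"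
    "\<And>\<mu>. \<mu> \<in> M_circle \<Longrightarrow> continuous_map stone_cech_discrete euclidean (\<lambda>x. G x \<mu>)"
    "\<And>\<mu> n. \<mu> \<in> M_circle \<Longrightarrow> G (discrete_embedding n) \<mu> = h n \<mu>"
proof -
  have "\<exists>g. continuous_map stone_cech_discrete euclidean g \<and> (\<forall>n. g (discrete_embedding n) = h n \<mu>)"
    if "\<mu> \<in> M_circle" for \<mu>
  proof -
    have "bounded (range (\<lambda>n. h n \<mu>))"
      using h that by (auto simp: bounded_iff fourier_dominated_characters_def)
    then show ?thesis using stone_cech_discrete_extension by metis
  qed
  then obtain g where g: "\<And>\<mu>. \<mu> \<in> M_circle \<Longrightarrow> continuous_map stone_cech_discrete euclidean (g \<mu>)"
    "\<And>\<mu> n. \<mu> \<in> M_circle \<Longrightarrow> g \<mu> (discrete_embedding n) = h n \<mu>"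
    by metis
  \<comment> \<open>Continuous maps into a Hausdorff space that agree on a dense set are equal; each
    algebraic identity below is an instance.\<close>
  have id: "f x = f' x"
    if "x \<in> topspace stone_cech_discrete"
      "continuous_map stone_cech_discrete euclidean f" "continuous_map stone_cech_discrete euclidean f'"
      "\<And>n. f (discrete_embedding n) = f' (discrete_embedding n)"
    for x and f f' :: "(('a \<Rightarrow> real) \<Rightarrow> real) \<Rightarrow> complex"
  proof (rule forall_in_closure_of_eq[OF _ _ that(2,3)])
    show "x \<in> stone_cech_discrete closure_of (discrete_embedding ` UNIV)"
      using stone_cech_dense[of "discrete_topology (UNIV :: 'a set)"] that(1) by simp
  qed (use that(4) in auto)
  have add: "continuous_map stone_cech_discrete euclidean (\<lambda>x. g \<mu> x + g \<nu> x)" if "\<mu> \<in> M_circle" "\<nu> \<in> M_circle" for \<mu> \<nu>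
    using that by (intro continuous_map_add g(1))
  have mult: "continuous_map stone_cech_discrete euclidean (\<lambda>x. g \<mu> x * g \<nu> x)" if "\<mu> \<in> M_circle" "\<nu> \<in> M_circle" for \<mu> \<nu>
    using continuous_map_compose[OF continuous_map_pairedI[OF g(1)[OF that(1)] g(1)[OF that(2)]], of euclidean "\<lambda>(a, b). a * b"]
    by (simp add: o_def case_prod_beta euclidean_product_topology continuous_intros)
  have scale: "continuous_map stone_cech_discrete euclidean (\<lambda>x. c * g \<mu> x)" if "\<mu> \<in> M_circle" for c \<mu>
    using continuous_map_compose[OF g(1)[OF that], of euclidean "\<lambda>a. c * a"]
    by (simp add: o_def continuous_intros)
  have one: "point_mass 1 \<in> M_circle" by (rule point_mass_M_circle) simp
  have "(\<lambda>\<mu>. g \<mu> x) \<in> fourier_dominated_characters" if x: "x \<in> topspace stone_cech_discrete" for x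
    unfolding fourier_dominated_characters_def
  proof (intro CollectI conjI ballI allI)
    fix \<mu> assume \<mu>: "\<mu> \<in> M_circle"
    show "g (\<lambda>E. c * \<mu> E) x = c * g \<mu> x" for c
      by (rule id[OF x g(1)[OF M_circle_scale[OF \<mu>]] scale[OF \<mu>]])
         (use \<mu> h in \<open>simp add: g(2) M_circle_scale fourier_dominated_characters_def\<close>)
    show "g (\<lambda>E. \<mu> E + \<nu> E) x = g \<mu> x + g \<nu> x" if "\<nu> \<in> M_circle" for \<nu>
      by (rule id[OF x g(1)[OF M_circle_add[OF \<mu> that]] add[OF \<mu> that]])
         (use \<mu> that h in \<open>simp add: g(2) M_circle_add fourier_dominated_characters_def\<close>)
    show "g (convolution \<mu> \<nu>) x = g \<mu> x * g \<nu> x" if "\<nu> \<in> M_circle" for \<nu>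
      by (rule id[OF x g(1)[OF M_circle_convolution[OF \<mu> that]] mult[OF \<mu> that]])
         (use \<mu> that h in \<open>simp add: g(2) M_circle_convolution fourier_dominated_characters_def\<close>)
    have "x \<in> stone_cech_discrete closure_of (discrete_embedding ` UNIV)"
      using stone_cech_dense[of "discrete_topology (UNIV :: 'a set)"] x by simp
    then have "g \<mu> x \<in> cball 0 (SUP k. cmod (fourier k \<mu>))"
      by (rule closure_of_imp_closed[OF _ g(1)[OF \<mu>]])
         (use \<mu> h in \<open>auto simp: g(2) fourier_dominated_characters_def\<close>)
    then show "cmod (g \<mu> x) \<le> (SUP k. cmod (fourier k \<mu>))" by simp
  next
    show "g (point_mass 1) x = 1"
      by (rule id[OF x g(1)[OF one]]) (use one h in \<open>simp_all add: g(2) fourier_dominated_characters_def\<close>)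
  qed
  then show ?thesis
    by (rule that[of "\<lambda>x \<mu>. g \<mu> x"]) (simp_all add: g)
qed

text \<open>A continuous injection of a compact space into a Hausdorff space is an embedding.
  Injectivity holds because distinct points are told apart by some A, and the measure attached to A
  sends them into disjoint half-planes. The last conclusion passes closed constraints from the
  generators to the whole copy and later gives disjointness.\<close>

lemma stone_cech_copy_in_gelfand_space:
  fixes h :: "'a \<Rightarrow> (complex set \<Rightarrow> complex) \<Rightarrow> complex"
  assumes h: "\<And>n. h n \<in> fourier_dominated_characters"
    and sep: "\<And>A. \<exists>\<mu>\<in>M_circle. \<forall>n. (n \<in> A \<longrightarrow> Re (h n \<mu>) \<le> - 1 / 2) \<and> (n \<notin> A \<longrightarrow> 1 / 2 \<le> Re (h n \<mu>))"
  obtains S where "S \<subseteq> topspace gelfand_space" "S \<noteq> {}"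
    "subtopology gelfand_space S homeomorphic_space stone_cech (discrete_topology (UNIV :: 'a set))"
    "\<And>\<phi> \<mu> K. \<lbrakk>\<phi> \<in> S; \<mu> \<in> M_circle; closed K; \<And>n. h n \<mu> \<in> K\<rbrakk> \<Longrightarrow> \<phi> \<mu> \<in> K"
proof -
  obtain G where G: "\<And>x. x \<in> topspace stone_cech_discrete \<Longrightarrow> G x \<in> fourier_dominated_characters"
    "\<And>\<mu>. \<mu> \<in> M_circle \<Longrightarrow> continuous_map stone_cech_discrete euclidean (\<lambda>x. G x \<mu>)"
    "\<And>\<mu> n. \<mu> \<in> M_circle \<Longrightarrow> G (discrete_embedding n) \<mu> = h n \<mu>"
    by (rule dominated_character_extension[of h, OF h]) (rule that)
  define F where "F x = restrict (G x) M_circle" for x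
  define S where "S = F ` topspace stone_cech_discrete"
  have img: "F x \<in> M_circle_characters" if "x \<in> topspace stone_cech_discrete" for x
    unfolding F_def by (rule restrict_dominated_character[OF G(1)[OF that]])
  have cont: "continuous_map stone_cech_discrete gelfand_space F"
    unfolding gelfand_space_def continuous_map_in_subtopology continuous_map_componentwise
    using img G(2) by (auto simp: F_def)
  have "inj_on F (topspace stone_cech_discrete)"
  proof (rule inj_onI, rule ccontr)
    fix x y :: "('a \<Rightarrow> real) \<Rightarrow> real"
    assume x: "x \<in> topspace stone_cech_discrete" and y: "y \<in> topspace stone_cech_discrete"
      and eq: "F x = F y" and "x \<noteq> y"
    then obtain A where A: "x \<in> stone_cech_discrete closure_of (discrete_embedding ` A)"
      "y \<in> stone_cech_discrete closure_of (discrete_embedding ` (- A))"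
      using stone_cech_discrete_separation by metis
    obtain \<mu> where \<mu>: "\<mu> \<in> M_circle" and *: "\<And>n. n \<in> A \<Longrightarrow> Re (h n \<mu>) \<le> - 1 / 2" "\<And>n. n \<notin> A \<Longrightarrow> 1 / 2 \<le> Re (h n \<mu>)"
      using sep[of A] by blast
    have "G x \<mu> \<in> {z. Re z \<le> - 1 / 2}"
      by (rule closure_of_imp_closed[OF A(1) G(2)[OF \<mu>] closed_halfspace_Re_le]) (use * G(3)[OF \<mu>] in auto)
    moreover have "G y \<mu> \<in> {z. Re z \<ge> 1 / 2}"
      by (rule closure_of_imp_closed[OF A(2) G(2)[OF \<mu>] closed_halfspace_Re_ge]) (use * G(3)[OF \<mu>] in auto)
    moreover have "G x \<mu> = G y \<mu>"
      using fun_cong[OF eq, of \<mu>] \<mu> by (simp add: F_def)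
    ultimately show False by simp
  qed
  moreover have "Hausdorff_space gelfand_space"
    unfolding gelfand_space_def by (intro Hausdorff_space_subtopology) (simp add: Hausdorff_space_product_topology)
  ultimately have "embedding_map stone_cech_discrete gelfand_space F"
    using cont compact_space_stone_cech by (intro continuous_imp_embedding_map)
  then have hom: "subtopology gelfand_space S homeomorphic_space stone_cech (discrete_topology (UNIV :: 'a set))"
    unfolding S_def by (rule homeomorphic_space_sym[THEN iffD1, OF embedding_map_imp_homeomorphic_space])
  have sub: "S \<subseteq> topspace gelfand_space" using img by (auto simp: S_def topspace_gelfand_space)
  have ne: "S \<noteq> {}"
    unfolding S_def using stone_cech_embedding_in_topspace[of undefined "discrete_topology (UNIV :: 'a set)"] by auto
  have clo: "\<phi> \<mu> \<in> K" if "\<phi> \<in> S" "\<mu> \<in> M_circle" "closed K" "\<And>n. h n \<mu> \<in> K" for \<phi> \<mu> K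
  proof -
    obtain x where x: "x \<in> topspace stone_cech_discrete" "\<phi> = F x" using \<open>\<phi> \<in> S\<close> by (auto simp: S_def)
    have "x \<in> stone_cech_discrete closure_of (discrete_embedding ` UNIV)"
      using stone_cech_dense[of "discrete_topology (UNIV :: 'a set)"] x by simp
    then have "G x \<mu> \<in> K"
      by (rule closure_of_imp_closed[OF _ G(2)[OF that(2)] that(3)]) (use that(4) G(3)[OF that(2)] in auto)
    then show ?thesis using x that(2) by (simp add: F_def)
  qed
  show ?thesis by (rule that[OF sub ne hom]) (rule clo)
qed

text \<open>The extension of k -> \<open>fourier (p k)\<close> is evaluated at a free point. That
  point lies in the closure of every tail, so a closed constraint valid from some j on holds for the
  limit.\<close>

lemma fourier_subsequence_limit:
  fixes p :: "nat \<Rightarrow> nat"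
  obtains \<psi> where "\<psi> \<in> fourier_dominated_characters"
    "\<And>\<mu> K j. \<lbrakk>\<mu> \<in> M_circle; closed K; \<And>k. j \<le> k \<Longrightarrow> fourier (p k) \<mu> \<in> K\<rbrakk> \<Longrightarrow> \<psi> \<mu> \<in> K"
proof -
  obtain u :: "(nat \<Rightarrow> real) \<Rightarrow> real" where u: "\<And>k. u \<in> stone_cech_discrete closure_of (discrete_embedding ` {k..})"
    using stone_cech_discrete_free_point by metis
  obtain G where G: "\<And>x. x \<in> topspace stone_cech_discrete \<Longrightarrow> G x \<in> fourier_dominated_characters"
    "\<And>\<mu>. \<mu> \<in> M_circle \<Longrightarrow> continuous_map stone_cech_discrete euclidean (\<lambda>x. G x \<mu>)"
    "\<And>\<mu> k. \<mu> \<in> M_circle \<Longrightarrow> G (discrete_embedding k) \<mu> = fourier (p k) \<mu>"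
    using dominated_character_extension[of "\<lambda>k. fourier (p k)"] fourier_in_dominated by metis
  show ?thesis
  proof (rule that[of "G u"])
    have "u \<in> topspace stone_cech_discrete"
      using u[of 0] closure_of_subset_topspace[of stone_cech_discrete] by blast
    then show "G u \<in> fourier_dominated_characters" by (rule G)
  next
    fix \<mu> K j assume \<mu>: "\<mu> \<in> M_circle" and K: "closed K" "\<And>k. j \<le> k \<Longrightarrow> fourier (p k) \<mu> \<in> K"
    show "G u \<mu> \<in> K"
      by (rule closure_of_imp_closed[OF u[of j] G(2)[OF \<mu>] K(1)]) (use K(2) G(3)[OF \<mu>] in auto)
  qed
qed

section \<open>Disjoint copies indexed by the sets of naturals\<close>

theorem proposition7:
  shows "\<exists>\<F> :: ((complex set \<Rightarrow> complex) \<Rightarrow> complex) set set.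
    \<F> \<approx> (UNIV :: real set) \<and>
    pairwise disjnt \<F> \<and>
    (\<forall>S \<in> \<F>. S \<subseteq> topspace gelfand_space \<and>
      subtopology gelfand_space S homeomorphic_space
        stone_cech (discrete_topology (UNIV :: int set)))"
proof -
  let ?L = "{z. Re z \<le> - 1 / 2}" and ?R = "{z. 1 / 2 \<le> Re z}"
  have clos: "closed ?L" "closed ?R" by (rule closed_halfspace_Re_le closed_halfspace_Re_ge)+
  \<comment> \<open>The list of truth values records \<alpha> below k. Codes of distinct sets can
    therefore coincide only while k does not exceed the first place where the sets differ.\<close>
  define \<kappa> :: "int \<Rightarrow> nat \<Rightarrow> nat set \<Rightarrow> nat"
    where "\<kappa> n k \<alpha> = to_nat (n, k, map (\<lambda>i. i \<in> \<alpha>) [0..<k])" for n k \<alpha>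
  have \<kappa>: "n = n' \<and> k = k' \<and> (\<forall>i<k. i \<in> \<alpha> \<longleftrightarrow> i \<in> \<beta>)" if "\<kappa> n k \<alpha> = \<kappa> n' k' \<beta>" for n n' k k' \<alpha> \<beta>
    using that by (auto simp: \<kappa>_def)
  have "\<forall>\<alpha>. \<forall>n. \<exists>\<psi>. \<psi> \<in> fourier_dominated_characters \<and>
      (\<forall>\<mu> K j. \<mu> \<in> M_circle \<longrightarrow> closed K \<longrightarrow> (\<forall>k\<ge>j. fourier (4 ^ \<kappa> n k \<alpha>) \<mu> \<in> K) \<longrightarrow> \<psi> \<mu> \<in> K)"
  proof (intro allI)
    fix \<alpha> n
    show "\<exists>\<psi>. \<psi> \<in> fourier_dominated_characters \<and>
      (\<forall>\<mu> K j. \<mu> \<in> M_circle \<longrightarrow> closed K \<longrightarrow> (\<forall>k\<ge>j. fourier (4 ^ \<kappa> n k \<alpha>) \<mu> \<in> K) \<longrightarrow> \<psi> \<mu> \<in> K)"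
      using fourier_subsequence_limit[of "\<lambda>k. 4 ^ \<kappa> n k \<alpha>"] by metis
  qed
  then obtain \<psi> where "\<forall>\<alpha> n. \<psi> \<alpha> n \<in> fourier_dominated_characters \<and>
      (\<forall>\<mu> K j. \<mu> \<in> M_circle \<longrightarrow> closed K \<longrightarrow> (\<forall>k\<ge>j. fourier (4 ^ \<kappa> n k \<alpha>) \<mu> \<in> K) \<longrightarrow> \<psi> \<alpha> n \<mu> \<in> K)"
    unfolding choice_iff by (elim exE)
  then have \<psi>: "\<psi> \<alpha> n \<in> fourier_dominated_characters"
    and \<psi>_lim: "\<lbrakk>\<mu> \<in> M_circle; closed K; \<And>k. j \<le> k \<Longrightarrow> fourier (4 ^ \<kappa> n k \<alpha>) \<mu> \<in> K\<rbrakk> \<Longrightarrow> \<psi> \<alpha> n \<mu> \<in> K" for \<alpha> n \<mu> K j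
    by blast+
  have meas: "\<exists>\<mu>\<in>M_circle. (\<forall>m\<in>D. fourier (4 ^ m) \<mu> \<in> ?L) \<and> (\<forall>m. m \<notin> D \<longrightarrow> fourier (4 ^ m) \<mu> \<in> ?R)" for D
  proof -
    obtain t where t: "t \<in> circle" "\<And>m. m \<in> D \<Longrightarrow> Re (t ^ 4 ^ m) \<le> - 1 / 2" "\<And>m. m \<notin> D \<Longrightarrow> 1 / 2 \<le> Re (t ^ 4 ^ m)"
      using circle_lacunary_separation by metis
    then show ?thesis
      by (intro bexI[of _ "point_mass t"]) (auto simp: fourier_point_mass point_mass_M_circle)
  qed
  have sep: "\<exists>\<mu>\<in>M_circle. \<forall>n. (n \<in> A \<longrightarrow> Re (\<psi> \<alpha> n \<mu>) \<le> - 1 / 2) \<and> (n \<notin> A \<longrightarrow> 1 / 2 \<le> Re (\<psi> \<alpha> n \<mu>))" for \<alpha> A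
  proof -
    \<comment> \<open>A code determines its n, so the codes attached to any n outside A avoid this
      set altogether.\<close>
    let ?D = "{\<kappa> n k \<alpha> | n k. n \<in> A}"
    obtain \<mu> where \<mu>: "\<mu> \<in> M_circle" and L: "\<And>m. m \<in> ?D \<Longrightarrow> fourier (4 ^ m) \<mu> \<in> ?L"
      and R: "\<And>m. m \<notin> ?D \<Longrightarrow> fourier (4 ^ m) \<mu> \<in> ?R"
      using meas[of ?D] by blast
    have "\<psi> \<alpha> n \<mu> \<in> ?L" if "n \<in> A" for n
    proof (rule \<psi>_lim[OF \<mu> clos(1), of 0])
      fix k
      have "\<kappa> n k \<alpha> \<in> ?D" using that by blast
      then show "fourier (4 ^ \<kappa> n k \<alpha>) \<mu> \<in> ?L" by (rule L)
    qed
    moreover have "\<psi> \<alpha> n \<mu> \<in> ?R" if "n \<notin> A" for n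
    proof (rule \<psi>_lim[OF \<mu> clos(2), of 0])
      fix k
      have "\<kappa> n k \<alpha> \<notin> ?D" using that \<kappa> by blast
      then show "fourier (4 ^ \<kappa> n k \<alpha>) \<mu> \<in> ?R" by (rule R)
    qed
    ultimately show ?thesis using \<mu> by blast
  qed
  have "\<forall>\<alpha>. \<exists>S. S \<subseteq> topspace gelfand_space \<and> S \<noteq> {} \<and>
      subtopology gelfand_space S homeomorphic_space stone_cech (discrete_topology (UNIV :: int set)) \<and>
      (\<forall>\<phi> \<mu> K. \<phi> \<in> S \<longrightarrow> \<mu> \<in> M_circle \<longrightarrow> closed K \<longrightarrow> (\<forall>n. \<psi> \<alpha> n \<mu> \<in> K) \<longrightarrow> \<phi> \<mu> \<in> K)"
  proof
    fix \<alpha>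
    show "\<exists>S. S \<subseteq> topspace gelfand_space \<and> S \<noteq> {} \<and>
      subtopology gelfand_space S homeomorphic_space stone_cech (discrete_topology (UNIV :: int set)) \<and>
      (\<forall>\<phi> \<mu> K. \<phi> \<in> S \<longrightarrow> \<mu> \<in> M_circle \<longrightarrow> closed K \<longrightarrow> (\<forall>n. \<psi> \<alpha> n \<mu> \<in> K) \<longrightarrow> \<phi> \<mu> \<in> K)"
      by (rule stone_cech_copy_in_gelfand_space[of "\<psi> \<alpha>", OF \<psi> sep]) blast
  qed
  then obtain S where "\<forall>\<alpha>. S \<alpha> \<subseteq> topspace gelfand_space \<and> S \<alpha> \<noteq> {} \<and>
      subtopology gelfand_space (S \<alpha>) homeomorphic_space stone_cech (discrete_topology (UNIV :: int set)) \<and>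
      (\<forall>\<phi> \<mu> K. \<phi> \<in> S \<alpha> \<longrightarrow> \<mu> \<in> M_circle \<longrightarrow> closed K \<longrightarrow> (\<forall>n. \<psi> \<alpha> n \<mu> \<in> K) \<longrightarrow> \<phi> \<mu> \<in> K)"
    unfolding choice_iff by (elim exE)
  then have S: "S \<alpha> \<subseteq> topspace gelfand_space" "S \<alpha> \<noteq> {}"
      "subtopology gelfand_space (S \<alpha>) homeomorphic_space stone_cech (discrete_topology (UNIV :: int set))"
    and S_closed: "\<lbrakk>\<phi> \<in> S \<alpha>; \<mu> \<in> M_circle; closed K; \<And>n. \<psi> \<alpha> n \<mu> \<in> K\<rbrakk> \<Longrightarrow> \<phi> \<mu> \<in> K" for \<alpha> \<phi> \<mu> K
    by blast+
  have disj: "disjnt (S \<alpha>) (S \<beta>)" if "\<alpha> \<noteq> \<beta>" for \<alpha> \<beta>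
  proof -
    obtain j where j: "(j \<in> \<alpha>) \<noteq> (j \<in> \<beta>)" using \<open>\<alpha> \<noteq> \<beta>\<close> by blast
    \<comment> \<open>All codes of \<alpha>: one measure sends every generator for \<alpha> to the
      left half-plane and every generator for \<beta> to the right one.\<close>
    let ?D = "{\<kappa> n k \<alpha> | n k. True}"
    obtain \<mu> where \<mu>: "\<mu> \<in> M_circle" and L: "\<And>m. m \<in> ?D \<Longrightarrow> fourier (4 ^ m) \<mu> \<in> ?L"
      and R: "\<And>m. m \<notin> ?D \<Longrightarrow> fourier (4 ^ m) \<mu> \<in> ?R"
      using meas[of ?D] by blast
    have \<alpha>: "\<psi> \<alpha> n \<mu> \<in> ?L" for n
    proof (rule \<psi>_lim[OF \<mu> clos(1), of 0])
      fix k
      have "\<kappa> n k \<alpha> \<in> ?D" by blast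
      then show "fourier (4 ^ \<kappa> n k \<alpha>) \<mu> \<in> ?L" by (rule L)
    qed
    \<comment> \<open>\<open>Suc j\<close> is the least length at which a code records membership of
      j, so from there on no code of \<beta> is a code of \<alpha>. Shorter codes may coincide, but
      the limit ignores them.\<close>
    have \<beta>: "\<psi> \<beta> n \<mu> \<in> ?R" for n
    proof (rule \<psi>_lim[OF \<mu> clos(2), of "Suc j"])
      fix k assume "Suc j \<le> k"
      then have "\<kappa> n k \<beta> \<noteq> \<kappa> n' k' \<alpha>" for n' k'
        using \<kappa>[of n k \<beta> n' k' \<alpha>] j by (auto simp: Suc_le_eq)
      then have "\<kappa> n k \<beta> \<notin> ?D" by blast
      then show "fourier (4 ^ \<kappa> n k \<beta>) \<mu> \<in> ?R" by (rule R)
    qed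
    show ?thesis
      unfolding disjnt_iff
    proof (intro allI notI, elim conjE)
      fix \<phi> assume "\<phi> \<in> S \<alpha>" "\<phi> \<in> S \<beta>"
      then have "\<phi> \<mu> \<in> ?L" "\<phi> \<mu> \<in> ?R"
        using S_closed[OF _ \<mu> clos(1) \<alpha>] S_closed[OF _ \<mu> clos(2) \<beta>] by blast+
      then show False by simp
    qed
  qed
  \<comment> \<open>Nonempty disjoint sets are distinct, so the family has exactly the cardinality
    of the power set of the naturals.\<close>
  have "inj S"
  proof (rule injI, rule ccontr)
    fix \<alpha> \<beta> assume "S \<alpha> = S \<beta>" "\<alpha> \<noteq> \<beta>"
    with disj[of \<alpha> \<beta>] S(2)[of \<beta>] show False by simp
  qed
  then have "range S \<approx> (UNIV :: nat set set)"
    by (rule inj_on_image_eqpoll_self)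
  then have "range S \<approx> (UNIV :: real set)"
    using nat_sets_eqpoll_reals by (rule eqpoll_trans)
  moreover have "pairwise disjnt (range S)"
    unfolding pairwise_def using disj by (metis rangeE)
  ultimately show ?thesis
    using S(1,3) by (intro exI[of _ "range S"]) auto
qed

end
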